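(* Let $\mathcal C$ be a triangulated category, let $n\in\mathbb N$, and let $(\mathcal D,\mathcal T)$ be a right filterable pair of $t$-structures of type $(n,0)$ on $\mathcal C$. Then $(\mathcal D,\mathcal T)$ is obtained by an iterated HRS procedure of length $n$.
   Context: Full subcategories are closed under isomorphisms and additive. For a $t$-structure $\mathcal D=(\mathcal D^{\le 0},\mathcal D^{\ge 0})$ on a triangulated category $\mathcal C$ put $\mathcal D^{\le i}:=\mathcal D^{\le 0}[-i]$, $\mathcal D^{\ge i}:=\mathcal D^{\ge 0}[-i]$; $\mathcal D^{\le 0}$ is the aisle and $\mathcal D^{\ge 0}$ the co-aisle; $\mathcal H_{\mathcal D}=\mathcal D^{\le 0}\cap\mathcal D^{\ge 0}$ is the heart and $H^i_{\mathcal D}:\mathcal C\to\mathcal H_{\mathcal D}$ are the cohomological functors. All $t$-structures considered are non-degenerate: $\bigcap_i\mathcal D^{\le i}=0=\bigcap_i\mathcal D^{\ge i}$. A pair $(\mathcal D,\mathcal T)$ of $t$-structures is of type $(n,k)$ (gap $n\in\mathbb N$, shift $k\in\mathbb Z$) if $k$ is the maximal integer such that $\mathcal T^{\le k}\subseteq\mathcal D^{\le 0}$ and $n$ is the minimal natural number such that $\mathcal D^{\le -n}\subseteq\mathcal T^{\le k}$. The pair $(\mathcal D,\mathcal T)$ is right filterable if for every $i\in\mathbb Z$ the intersection $\mathcal D^{\ge i}\cap\mathcal T^{\ge 0}$ is the co-aisle of a $t$-structure on $\mathcal C$. Tilting: given a $t$-structure $\mathcal E$ and a torsion pair $(\mathcal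 X,\mathcal Y)$ in the abelian category $\mathcal H_{\mathcal E}$, the $t$-structure obtained by tilting $\mathcal E$ with respect to $(\mathcal X,\mathcal Y)$ has aisle $\{C : H^0_{\mathcal E}(C)\in\mathcal X,\ H^i_{\mathcal E}(C)=0\ \forall i>0\}$ and co-aisle $\{C : H^{-1}_{\mathcal E}(C)\in\mathcal Y,\ H^i_{\mathcal E}(C)=0\ \forall i<-1\}$. A pair $(\mathcal D,\mathcal T)$ is obtained by an iterated HRS procedure of length $m$ if there are $t$-structures $\mathcal E_0=\mathcal D,\mathcal E_1,\dots,\mathcal E_m=\mathcal T$ on $\mathcal C$ such that for $i=0,\dots,m-1$ the $t$-structure $\mathcal E_{i+1}$ is obtained by tilting $\mathcal E_i$ with respect to some torsion pair in $\mathcal H_{\mathcal E_i}$. *)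

theory Defs
  imports "HOL-Algebra.Group"
begin

section \<open>Additive categories\<close>

record ('o, 'm) category =
  Obj :: "'o set"
  Arr :: "'m set"
  Dom :: "'m \<Rightarrow> 'o"
  Cod :: "'m \<Rightarrow> 'o"
  Ident :: "'o \<Rightarrow> 'm"
  Comp :: "'m \<Rightarrow> 'm \<Rightarrow> 'm" (infixl \<open>\<cdot>\<index>\<close> 70)

definition Hom :: "('o, 'm, 'z) category_scheme \<Rightarrow> 'o \<Rightarrow> 'o \<Rightarrow> 'm set" where
  "Hom C A B = {f \<in> Arr C. Dom C f = A \<and> Cod C f = B}"

locale category =
  fixes C :: "('o, 'm, 'z) category_scheme" (structure)
  assumes Dom_closed: "f \<in> Arr C \<Longrightarrow> Dom C f \<in> Obj C"
    and Cod_closed: "f \<in> Arr C \<Longrightarrow> Cod C f \<in> Obj C"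
    and Ident_closed: "A \<in> Obj C \<Longrightarrow> Ident C A \<in> Hom C A A"
    and Comp_closed: "f \<in> Hom C A B \<Longrightarrow> g \<in> Hom C B D \<Longrightarrow> g \<cdot> f \<in> Hom C A D"
    and Comp_assoc:
      "f \<in> Hom C A B \<Longrightarrow> g \<in> Hom C B D \<Longrightarrow> h \<in> Hom C D E \<Longrightarrow> (h \<cdot> g) \<cdot> f = h \<cdot> (g \<cdot> f)"
    and Comp_Ident_right: "f \<in> Hom C A B \<Longrightarrow> f \<cdot> Ident C A = f"
    and Comp_Ident_left: "f \<in> Hom C A B \<Longrightarrow> Ident C B \<cdot> f = f"

definition is_iso :: "('o, 'm, 'z) category_scheme \<Rightarrow> 'o \<Rightarrow> 'o \<Rightarrow> 'm \<Rightarrow> bool" where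
  "is_iso C A B f \<longleftrightarrow> f \<in> Hom C A B \<and>
     (\<exists>g \<in> Hom C B A. g \<cdot>\<^bsub>C\<^esub> f = Ident C A \<and> f \<cdot>\<^bsub>C\<^esub> g = Ident C B)"

definition isomorphic :: "('o, 'm, 'z) category_scheme \<Rightarrow> 'o \<Rightarrow> 'o \<Rightarrow> bool" where
  "isomorphic C A B \<longleftrightarrow> (\<exists>f. is_iso C A B f)"

record ('o, 'm) preadditive_category = "('o, 'm) category" +
  Plus :: "'m \<Rightarrow> 'm \<Rightarrow> 'm"
  ZeroArr :: "'o \<Rightarrow> 'o \<Rightarrow> 'm"

definition hom_group :: "('o, 'm, 'z) preadditive_category_scheme \<Rightarrow> 'o \<Rightarrow> 'o \<Rightarrow> 'm monoid" where
  "hom_group C A B = \<lparr>carrier = Hom C A B, mult = Plus C, one = ZeroArr C A B\<rparr>"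

definition neg_arr :: "('o, 'm, 'z) preadditive_category_scheme \<Rightarrow> 'm \<Rightarrow> 'm" where
  "neg_arr C f = inv\<^bsub>hom_group C (Dom C f) (Cod C f)\<^esub> f"

definition zero_object :: "('o, 'm, 'z) preadditive_category_scheme \<Rightarrow> 'o \<Rightarrow> bool" where
  "zero_object C Z \<longleftrightarrow> Z \<in> Obj C \<and>
     (\<forall>A \<in> Obj C. (\<exists>!f. f \<in> Hom C A Z) \<and> (\<exists>!f. f \<in> Hom C Z A))"

definition biproduct :: "('o, 'm, 'z) preadditive_category_scheme \<Rightarrow> 'o \<Rightarrow> 'o \<Rightarrow> 'o \<Rightarrow> bool" where
  "biproduct C A B P \<longleftrightarrow> P \<in> Obj C \<and>
     (\<exists>i \<in> Hom C A P. \<exists>j \<in> Hom C B P. \<exists>p \<in> Hom C P A. \<exists>q \<in> Hom C P B.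
        p \<cdot>\<^bsub>C\<^esub> i = Ident C A \<and> q \<cdot>\<^bsub>C\<^esub> j = Ident C B \<and>
        q \<cdot>\<^bsub>C\<^esub> i = ZeroArr C A B \<and> p \<cdot>\<^bsub>C\<^esub> j = ZeroArr C B A \<and>
        Plus C (i \<cdot>\<^bsub>C\<^esub> p) (j \<cdot>\<^bsub>C\<^esub> q) = Ident C P)"

locale additive_category = category C
  for C :: "('o, 'm, 'z) preadditive_category_scheme" (structure) +
  assumes hom_comm_group: "A \<in> Obj C \<Longrightarrow> B \<in> Obj C \<Longrightarrow> comm_group (hom_group C A B)"
    and Comp_Plus_right:
      "f \<in> Hom C A B \<Longrightarrow> g \<in> Hom C A B \<Longrightarrow> h \<in> Hom C B D \<Longrightarrow>
        h \<cdot> Plus C f g = Plus C (h \<cdot> f) (h \<cdot> g)"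
    and Comp_Plus_left:
      "f \<in> Hom C A B \<Longrightarrow> g \<in> Hom C B D \<Longrightarrow> h \<in> Hom C B D \<Longrightarrow>
        Plus C g h \<cdot> f = Plus C (g \<cdot> f) (h \<cdot> f)"
    and zero_object_exists: "\<exists>Z. zero_object C Z"
    and biproduct_exists: "A \<in> Obj C \<Longrightarrow> B \<in> Obj C \<Longrightarrow> \<exists>P. biproduct C A B P"


section \<open>Triangulated categories\<close>

text \<open>A triangle \<open>X \<rightarrow> Y \<rightarrow> Z \<rightarrow> X[1]\<close> is recorded as the triple of its arrows. The shift is
  only required to be an autoequivalence, which includes the case of an automorphism.\<close>

record ('o, 'm) triangulated_category = "('o, 'm) preadditive_category" +
  Shift :: "'o \<Rightarrow> 'o"
  ShiftArr :: "'m \<Rightarrow> 'm"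
  Triangles :: "('m \<times> 'm \<times> 'm) set"

definition triangle ::
  "('o, 'm, 'z) triangulated_category_scheme \<Rightarrow> 'o \<Rightarrow> 'o \<Rightarrow> 'o \<Rightarrow> 'm \<Rightarrow> 'm \<Rightarrow> 'm \<Rightarrow> bool" where
  "triangle C X Y Z u v w \<longleftrightarrow>
     u \<in> Hom C X Y \<and> v \<in> Hom C Y Z \<and> w \<in> Hom C Z (Shift C X)"

definition dist_triangle ::
  "('o, 'm, 'z) triangulated_category_scheme \<Rightarrow> 'o \<Rightarrow> 'o \<Rightarrow> 'o \<Rightarrow> 'm \<Rightarrow> 'm \<Rightarrow> 'm \<Rightarrow> bool" where
  "dist_triangle C X Y Z u v w \<longleftrightarrow> triangle C X Y Z u v w \<and> (u, v, w) \<in> Triangles C"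

locale triangulated_category = additive_category C
  for C :: "('o, 'm, 'z) triangulated_category_scheme" (structure) +
  assumes Shift_closed: "A \<in> Obj C \<Longrightarrow> Shift C A \<in> Obj C"
    and ShiftArr_Ident: "A \<in> Obj C \<Longrightarrow> ShiftArr C (Ident C A) = Ident C (Shift C A)"
    and ShiftArr_Comp:
      "f \<in> Hom C A B \<Longrightarrow> g \<in> Hom C B D \<Longrightarrow> ShiftArr C (g \<cdot> f) = ShiftArr C g \<cdot> ShiftArr C f"
    and ShiftArr_Plus:
      "f \<in> Hom C A B \<Longrightarrow> g \<in> Hom C A B \<Longrightarrow>
        ShiftArr C (Plus C f g) = Plus C (ShiftArr C f) (ShiftArr C g)"
    and Shift_fully_faithful:
      "A \<in> Obj C \<Longrightarrow> B \<in> Obj C \<Longrightarrow>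
        bij_betw (ShiftArr C) (Hom C A B) (Hom C (Shift C A) (Shift C B))"
    and Shift_ess_surj: "A \<in> Obj C \<Longrightarrow> \<exists>B \<in> Obj C. isomorphic C (Shift C B) A"
    and Triangles_triangle: "(u, v, w) \<in> Triangles C \<Longrightarrow> \<exists>X Y Z. triangle C X Y Z u v w"
    and TR1_iso:
      "dist_triangle C X Y Z u v w \<Longrightarrow> triangle C X' Y' Z' u' v' w' \<Longrightarrow>
        is_iso C X X' f \<Longrightarrow> is_iso C Y Y' g \<Longrightarrow> is_iso C Z Z' h \<Longrightarrow>
        g \<cdot> u = u' \<cdot> f \<Longrightarrow> h \<cdot> v = v' \<cdot> g \<Longrightarrow> ShiftArr C f \<cdot> w = w' \<cdot> h \<Longrightarrow>
        dist_triangle C X' Y' Z' u' v' w'"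
    and TR1_Ident:
      "X \<in> Obj C \<Longrightarrow> zero_object C Z \<Longrightarrow>
        dist_triangle C X X Z (Ident C X) (ZeroArr C X Z) (ZeroArr C Z (Shift C X))"
    and TR1_cone: "u \<in> Hom C X Y \<Longrightarrow> \<exists>Z v w. dist_triangle C X Y Z u v w"
    and TR2:
      "triangle C X Y Z u v w \<Longrightarrow>
        dist_triangle C X Y Z u v w \<longleftrightarrow>
        dist_triangle C Y Z (Shift C X) v w (neg_arr C (ShiftArr C u))"
    and TR3:
      "dist_triangle C X Y Z u v w \<Longrightarrow> dist_triangle C X' Y' Z' u' v' w' \<Longrightarrow>
        f \<in> Hom C X X' \<Longrightarrow> g \<in> Hom C Y Y' \<Longrightarrow> g \<cdot> u = u' \<cdot> f \<Longrightarrow>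
        \<exists>h \<in> Hom C Z Z'. h \<cdot> v = v' \<cdot> g \<and> ShiftArr C f \<cdot> w = w' \<cdot> h"
    and TR4:
      "dist_triangle C X Y Z' u j k \<Longrightarrow> dist_triangle C Y Z X' v l i \<Longrightarrow>
        dist_triangle C X Z Y' (v \<cdot> u) m n \<Longrightarrow>
        \<exists>f \<in> Hom C Z' Y'. \<exists>g \<in> Hom C Y' X'.
          dist_triangle C Z' Y' X' f g (ShiftArr C j \<cdot> i) \<and>
          f \<cdot> j = m \<cdot> v \<and> n \<cdot> f = k \<and> g \<cdot> m = l \<and> i \<cdot> g = ShiftArr C u \<cdot> n"

text \<open>For \<open>i < 0\<close> the object \<open>X[i]\<close> is determined only up to isomorphism.\<close>

definition shift_obj :: "('o, 'm, 'z) triangulated_category_scheme \<Rightarrow> int \<Rightarrow> 'o \<Rightarrow> 'o" where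
  "shift_obj C i X =
     (if 0 \<le> i then (Shift C ^^ nat i) X
      else (SOME Y. Y \<in> Obj C \<and> isomorphic C ((Shift C ^^ nat (- i)) Y) X))"

definition shift_class ::
  "('o, 'm, 'z) triangulated_category_scheme \<Rightarrow> int \<Rightarrow> 'o set \<Rightarrow> 'o set" where
  "shift_class C i S = {X \<in> Obj C. \<exists>Y \<in> S. isomorphic C X (shift_obj C i Y)}"


section \<open>Full subcategories and torsion pairs\<close>

text \<open>A full subcategory is given by its class of objects; it is always assumed to be closed under
  isomorphisms and additive.\<close>

definition full_subcategory :: "('o, 'm, 'z) preadditive_category_scheme \<Rightarrow> 'o set \<Rightarrow> bool" where
  "full_subcategory C S \<longleftrightarrow> S \<subseteq> Obj C \<and>
     (\<forall>A \<in> S. \<forall>B \<in> Obj C. isomorphic C A B \<longrightarrow> B \<in> S) \<and>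
     (\<forall>Z. zero_object C Z \<longrightarrow> Z \<in> S) \<and>
     (\<forall>A \<in> S. \<forall>B \<in> S. \<forall>P. biproduct C A B P \<longrightarrow> P \<in> S)"

definition restrict_category ::
  "('o, 'm, 'z) preadditive_category_scheme \<Rightarrow> 'o set \<Rightarrow> ('o, 'm) preadditive_category" where
  "restrict_category C S =
     \<lparr>Obj = S, Arr = {f \<in> Arr C. Dom C f \<in> S \<and> Cod C f \<in> S}, Dom = Dom C, Cod = Cod C,
      Ident = Ident C, Comp = Comp C, Plus = Plus C, ZeroArr = ZeroArr C\<rparr>"

definition is_kernel ::
  "('o, 'm, 'z) preadditive_category_scheme \<Rightarrow> 'o \<Rightarrow> 'o \<Rightarrow> 'o \<Rightarrow> 'm \<Rightarrow> 'm \<Rightarrow> bool" where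
  "is_kernel A K L M f g \<longleftrightarrow> f \<in> Hom A K L \<and> g \<in> Hom A L M \<and> g \<cdot>\<^bsub>A\<^esub> f = ZeroArr A K M \<and>
     (\<forall>W \<in> Obj A. \<forall>h \<in> Hom A W L. g \<cdot>\<^bsub>A\<^esub> h = ZeroArr A W M \<longrightarrow>
        (\<exists>!h'. h' \<in> Hom A W K \<and> f \<cdot>\<^bsub>A\<^esub> h' = h))"

definition is_cokernel ::
  "('o, 'm, 'z) preadditive_category_scheme \<Rightarrow> 'o \<Rightarrow> 'o \<Rightarrow> 'o \<Rightarrow> 'm \<Rightarrow> 'm \<Rightarrow> bool" where
  "is_cokernel A K L M f g \<longleftrightarrow> f \<in> Hom A K L \<and> g \<in> Hom A L M \<and> g \<cdot>\<^bsub>A\<^esub> f = ZeroArr A K M \<and>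
     (\<forall>W \<in> Obj A. \<forall>h \<in> Hom A L W. h \<cdot>\<^bsub>A\<^esub> f = ZeroArr A K W \<longrightarrow>
        (\<exists>!h'. h' \<in> Hom A M W \<and> h' \<cdot>\<^bsub>A\<^esub> g = h))"

definition short_exact ::
  "('o, 'm, 'z) preadditive_category_scheme \<Rightarrow> 'o \<Rightarrow> 'o \<Rightarrow> 'o \<Rightarrow> 'm \<Rightarrow> 'm \<Rightarrow> bool" where
  "short_exact A K L M f g \<longleftrightarrow> is_kernel A K L M f g \<and> is_cokernel A K L M f g"

text \<open>The category \<open>A\<close> is meant to be abelian.\<close>

definition torsion_pair ::
  "('o, 'm, 'z) preadditive_category_scheme \<Rightarrow> 'o set \<Rightarrow> 'o set \<Rightarrow> bool" where
  "torsion_pair A X Y \<longleftrightarrow> full_subcategory A X \<and> full_subcategory A Y \<and>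
     (\<forall>K \<in> X. \<forall>M \<in> Y. Hom A K M = {ZeroArr A K M}) \<and>
     (\<forall>L \<in> Obj A. \<exists>K \<in> X. \<exists>M \<in> Y. \<exists>f g. short_exact A K L M f g)"


section \<open>t-structures\<close>

text \<open>A t-structure is the pair consisting of its aisle and its co-aisle.\<close>

type_synonym 'o tstr = "'o set \<times> 'o set"

abbreviation aisle :: "'o tstr \<Rightarrow> 'o set" where
  "aisle D \<equiv> fst D"

abbreviation coaisle :: "'o tstr \<Rightarrow> 'o set" where
  "coaisle D \<equiv> snd D"

definition le_part :: "('o, 'm, 'z) triangulated_category_scheme \<Rightarrow> 'o tstr \<Rightarrow> int \<Rightarrow> 'o set" where
  "le_part C D i = shift_class C (- i) (aisle D)"

definition ge_part :: "('o, 'm, 'z) triangulated_category_scheme \<Rightarrow> 'o tstr \<Rightarrow> int \<Rightarrow> 'o set" where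
  "ge_part C D i = shift_class C (- i) (coaisle D)"

definition non_degenerate :: "('o, 'm, 'z) triangulated_category_scheme \<Rightarrow> 'o tstr \<Rightarrow> bool" where
  "non_degenerate C D \<longleftrightarrow>
     (\<Inter>i. le_part C D i) = {Z. zero_object C Z} \<and> (\<Inter>i. ge_part C D i) = {Z. zero_object C Z}"

text \<open>All t-structures are required to be non-degenerate.\<close>

definition t_structure :: "('o, 'm, 'z) triangulated_category_scheme \<Rightarrow> 'o tstr \<Rightarrow> bool" where
  "t_structure C D \<longleftrightarrow>
     full_subcategory C (aisle D) \<and> full_subcategory C (coaisle D) \<and>
     aisle D \<subseteq> le_part C D 1 \<and> ge_part C D 1 \<subseteq> coaisle D \<and>
     (\<forall>A \<in> aisle D. \<forall>B \<in> ge_part C D 1. Hom C A B = {ZeroArr C A B}) \<and>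
     (\<forall>X \<in> Obj C. \<exists>A \<in> aisle D. \<exists>B \<in> ge_part C D 1. \<exists>u v w. dist_triangle C A X B u v w) \<and>
     non_degenerate C D"

definition heart_objects :: "'o tstr \<Rightarrow> 'o set" where
  "heart_objects D = aisle D \<inter> coaisle D"

definition heart ::
  "('o, 'm, 'z) triangulated_category_scheme \<Rightarrow> 'o tstr \<Rightarrow> ('o, 'm) preadditive_category" where
  "heart C D = restrict_category C (heart_objects D)"

text \<open>The truncations and the cohomologies \<open>H\<^sup>i(X) = \<tau>\<^bsup>\<ge>0\<^esup> \<tau>\<^bsup>\<le>0\<^esup> (X[i])\<close> are
  determined up to isomorphism; only their values on objects are needed, and these are only tested
  for membership in isomorphism-closed classes.\<close>

definition trunc_le :: "('o, 'm, 'z) triangulated_category_scheme \<Rightarrow> 'o tstr \<Rightarrow> 'o \<Rightarrow> 'o" where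
  "trunc_le C D X =
     (SOME A. A \<in> aisle D \<and> (\<exists>B \<in> ge_part C D 1. \<exists>u v w. dist_triangle C A X B u v w))"

definition trunc_ge :: "('o, 'm, 'z) triangulated_category_scheme \<Rightarrow> 'o tstr \<Rightarrow> 'o \<Rightarrow> 'o" where
  "trunc_ge C D X =
     (SOME B. B \<in> coaisle D \<and> (\<exists>A \<in> le_part C D (- 1). \<exists>u v w. dist_triangle C A X B u v w))"

definition cohomology ::
  "('o, 'm, 'z) triangulated_category_scheme \<Rightarrow> 'o tstr \<Rightarrow> int \<Rightarrow> 'o \<Rightarrow> 'o" where
  "cohomology C D i X = trunc_ge C D (trunc_le C D (shift_obj C i X))"


section \<open>Pairs of t-structures\<close>

definition has_type ::
  "('o, 'm, 'z) triangulated_category_scheme \<Rightarrow> 'o tstr \<Rightarrow> 'o tstr \<Rightarrow> nat \<Rightarrow> int \<Rightarrow> bool" where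
  "has_type C D T n k \<longleftrightarrow>
     le_part C T k \<subseteq> aisle D \<and> (\<forall>k'. le_part C T k' \<subseteq> aisle D \<longrightarrow> k' \<le> k) \<and>
     le_part C D (- int n) \<subseteq> le_part C T k \<and>
     (\<forall>n'. le_part C D (- int n') \<subseteq> le_part C T k \<longrightarrow> n \<le> n')"

definition right_filterable ::
  "('o, 'm, 'z) triangulated_category_scheme \<Rightarrow> 'o tstr \<Rightarrow> 'o tstr \<Rightarrow> bool" where
  "right_filterable C D T \<longleftrightarrow>
     (\<forall>i. \<exists>E. t_structure C E \<and> coaisle E = ge_part C D i \<inter> coaisle T)"

definition tilt ::
  "('o, 'm, 'z) triangulated_category_scheme \<Rightarrow> 'o tstr \<Rightarrow> 'o set \<Rightarrow> 'o set \<Rightarrow> 'o tstr" where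
  "tilt C E X Y =
     ({A \<in> Obj C. cohomology C E 0 A \<in> X \<and> (\<forall>i > 0. zero_object C (cohomology C E i A))},
      {A \<in> Obj C. cohomology C E (- 1) A \<in> Y \<and> (\<forall>i < - 1. zero_object C (cohomology C E i A))})"

definition iterated_HRS ::
  "('o, 'm, 'z) triangulated_category_scheme \<Rightarrow> 'o tstr \<Rightarrow> 'o tstr \<Rightarrow> nat \<Rightarrow> bool" where
  "iterated_HRS C D T m \<longleftrightarrow>
     (\<exists>E :: nat \<Rightarrow> 'o tstr.
        E 0 = D \<and> E m = T \<and> (\<forall>i \<le> m. t_structure C (E i)) \<and>
        (\<forall>i < m. \<exists>X Y. torsion_pair (heart C (E i)) X Y \<and> E (Suc i) = tilt C (E i) X Y))"

end

theory Submission
  imports Defs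
begin

text \<open>For \<open>i \<in> {0..n}\<close> let \<open>E\<^sub>i\<close> be the t-structure with co-aisle
  \<open>D\<^bsup>\<ge>-i\<^esup> \<inter> T\<^bsup>\<ge>0\<^esup>\<close>, which right filterability provides. Passing to orthogonals in
  \<open>T\<^bsup>\<le>0\<^esup> \<subseteq> D\<^bsup>\<le>0\<^esup>\<close> and \<open>D\<^bsup>\<le>-n\<^esup> \<subseteq> T\<^bsup>\<le>0\<^esup>\<close> gives
  \<open>D\<^bsup>\<ge>0\<^esup> \<subseteq> T\<^bsup>\<ge>0\<^esup> \<subseteq> D\<^bsup>\<ge>-n\<^esup>\<close>. Hence \<open>E\<^sub>0\<close> has the co-aisle of \<open>D\<close>, \<open>E\<^sub>n\<close> that of \<open>T\<close>,
  and a t-structure is determined by its co-aisle (\<open>eq_if_coaisle_eq\<close>). So the sequence joins \<open>D\<close>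
  to \<open>T\<close>, and only consecutive members remain to be compared.

  For \<open>E = E\<^sub>i\<close> and \<open>F = E\<^bsub>i+1\<^esub>\<close> the definition shows
  \<open>F\<^bsup>\<ge>1\<^esup> = D\<^bsup>\<ge>-i\<^esup> \<inter> T\<^bsup>\<ge>1\<^esup> \<subseteq> E\<^bsup>\<ge>0\<^esup> \<subseteq> F\<^bsup>\<ge>0\<^esup>\<close>. Any pair of t-structures with these two inclusions is a
  tilt (the locale \<open>tilted_pair\<close>), with respect to the torsion pair formed by
  \<open>F\<^bsup>\<le>0\<^esup>\<close> and \<open>F\<^bsup>\<ge>1\<^esup>\<close> inside the heart of \<open>E\<close>. Indeed the \<open>F\<close>-truncation
  triangle of an object of the heart of \<open>E\<close> lies in that heart, so it is the short exact sequence
  that a torsion pair asks for (\<open>torsion_pair\<close>). For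
  \<open>X \<in> E\<^bsup>\<ge>-1\<^esup>\<close> the object \<open>H\<^bsup>-1\<^esup>(X)[1]\<close> differs from \<open>X\<close> by an object of \<open>E\<^bsup>\<ge>0\<^esup> \<subseteq> F\<^bsup>\<ge>0\<^esup>\<close>, so it decides whether
  \<open>X \<in> F\<^bsup>\<ge>0\<^esup>\<close>; the aisle is dual (\<open>tilt_eq\<close>).

  The tilt is described by vanishing of cohomology, whereas the argument uses aisles and co-aisles.
  The two languages are connected by \<open>le_iff_cohomology\<close> and \<open>ge_iff_cohomology\<close>: this is
  where non-degeneracy enters.

  Except for the exactness of \<open>Hom\<close>, the uniqueness of truncations and the short exact sequences
  in the heart, the proof only needs to know which triples of objects are the vertices of a distinguished triangle. That relation (\<open>tri\<close>) is
  invariant under isomorphism and under all integral shifts, although negative shifts of objects are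
  chosen only up to isomorphism and negative shifts of arrows are not given at all.\<close>

section \<open>Zero morphisms and orthogonality in additive categories\<close>

context additive_category
begin

lemma Hom_Obj: "f \<in> Hom C A B \<Longrightarrow> A \<in> Obj C \<and> B \<in> Obj C"
  using Dom_closed Cod_closed by (auto simp: Hom_def)

lemma Hom_group_ops:
  assumes "A \<in> Obj C" "B \<in> Obj C"
  shows Zero_closed: "ZeroArr C A B \<in> Hom C A B"
    and Plus_closed: "f \<in> Hom C A B \<Longrightarrow> g \<in> Hom C A B \<Longrightarrow> Plus C f g \<in> Hom C A B"
    and Plus_self: "f \<in> Hom C A B \<Longrightarrow> Plus C f f = f \<Longrightarrow> f = ZeroArr C A B"
    and Plus_Zero: "f \<in> Hom C A B \<Longrightarrow> Plus C f (ZeroArr C A B) = f"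
    and neg_closed: "f \<in> Hom C A B \<Longrightarrow> neg_arr C f \<in> Hom C A B"
    and Plus_neg: "f \<in> Hom C A B \<Longrightarrow> Plus C f (neg_arr C f) = ZeroArr C A B"
    and neg_unique: "f \<in> Hom C A B \<Longrightarrow> g \<in> Hom C A B \<Longrightarrow> Plus C f g = ZeroArr C A B
      \<Longrightarrow> neg_arr C f = g"
    and neg_neg: "f \<in> Hom C A B \<Longrightarrow> neg_arr C (neg_arr C f) = f"
    and eq_if_diff_Zero: "f \<in> Hom C A B \<Longrightarrow> g \<in> Hom C A B
      \<Longrightarrow> Plus C f (neg_arr C g) = ZeroArr C A B \<Longrightarrow> f = g"
proof -
  interpret G: comm_group "hom_group C A B"
    using assms by (rule hom_comm_group)
  have c: "carrier (hom_group C A B) = Hom C A B" "mult (hom_group C A B) = Plus C"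
    "one (hom_group C A B) = ZeroArr C A B"
    by (auto simp: hom_group_def)
  have n: "neg_arr C f = inv\<^bsub>hom_group C A B\<^esub> f" if "f \<in> Hom C A B" for f
    using that by (simp add: neg_arr_def Hom_def)
  show "ZeroArr C A B \<in> Hom C A B" using G.one_closed c by simp
  show "f \<in> Hom C A B \<Longrightarrow> g \<in> Hom C A B \<Longrightarrow> Plus C f g \<in> Hom C A B"
    using G.m_closed c by simp
  show "f \<in> Hom C A B \<Longrightarrow> Plus C f f = f \<Longrightarrow> f = ZeroArr C A B"
    using G.l_cancel_one[of f f] c by simp
  show "f \<in> Hom C A B \<Longrightarrow> Plus C f (ZeroArr C A B) = f"
    using G.r_one c by simp
  show nc: "f \<in> Hom C A B \<Longrightarrow> neg_arr C f \<in> Hom C A B" for f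
    using G.inv_closed c n by simp
  show "f \<in> Hom C A B \<Longrightarrow> Plus C f (neg_arr C f) = ZeroArr C A B"
    using G.r_inv c n by simp
  show "f \<in> Hom C A B \<Longrightarrow> g \<in> Hom C A B \<Longrightarrow> Plus C f g = ZeroArr C A B
      \<Longrightarrow> neg_arr C f = g"
    using G.inv_equality[of g f] G.m_comm[of g f] c n by simp
  show "f \<in> Hom C A B \<Longrightarrow> neg_arr C (neg_arr C f) = f"
    using G.inv_inv[of f] c n nc by simp
  show "f \<in> Hom C A B \<Longrightarrow> g \<in> Hom C A B
      \<Longrightarrow> Plus C f (neg_arr C g) = ZeroArr C A B \<Longrightarrow> f = g"
    using G.inv_equality[of f "inv\<^bsub>hom_group C A B\<^esub> g"] c n nc by simp
qed

lemma Comp_Zero_right: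
  assumes h: "h \<in> Hom C B D" and A: "A \<in> Obj C"
  shows "h \<cdot> ZeroArr C A B = ZeroArr C A D"
proof -
  have o: "B \<in> Obj C" "D \<in> Obj C" using h Hom_Obj by auto
  note z = Zero_closed[OF A o(1)]
  show ?thesis
    using Plus_self[OF A o(2) Comp_closed[OF z h]] Comp_Plus_right[OF z z h]
      Plus_Zero[OF A o(1) z] by simp
qed

lemma Comp_Zero_left:
  assumes f: "f \<in> Hom C A B" and D: "D \<in> Obj C"
  shows "ZeroArr C B D \<cdot> f = ZeroArr C A D"
proof -
  have o: "A \<in> Obj C" "B \<in> Obj C" using f Hom_Obj by auto
  note z = Zero_closed[OF o(2) D]
  show ?thesis
    using Plus_self[OF o(1) D Comp_closed[OF f z]] Comp_Plus_left[OF f z z]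
      Plus_Zero[OF o(2) D z] by simp
qed

lemma Comp_neg_right:
  assumes f: "f \<in> Hom C A B" and h: "h \<in> Hom C B D"
  shows "h \<cdot> neg_arr C f = neg_arr C (h \<cdot> f)"
proof -
  have o: "A \<in> Obj C" "B \<in> Obj C" "D \<in> Obj C" using f h Hom_Obj by auto
  note n = neg_closed[OF o(1,2) f]
  show ?thesis
    using neg_unique[OF o(1,3) Comp_closed[OF f h] Comp_closed[OF n h]] Comp_Plus_right[OF f n h]
      Plus_neg[OF o(1,2) f] Comp_Zero_right[OF h o(1)] by simp
qed

lemma Comp_neg_left:
  assumes f: "f \<in> Hom C A B" and h: "h \<in> Hom C B D"
  shows "neg_arr C h \<cdot> f = neg_arr C (h \<cdot> f)"
proof -
  have o: "A \<in> Obj C" "B \<in> Obj C" "D \<in> Obj C" using f h Hom_Obj by auto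
  note n = neg_closed[OF o(2,3) h]
  show ?thesis
    using neg_unique[OF o(1,3) Comp_closed[OF f h] Comp_closed[OF f n]] Comp_Plus_left[OF f h n]
      Plus_neg[OF o(2,3) h] Comp_Zero_left[OF f o(3)] by simp
qed

lemma neg_Zero: "A \<in> Obj C \<Longrightarrow> B \<in> Obj C \<Longrightarrow> neg_arr C (ZeroArr C A B) = ZeroArr C A B"
  by (simp add: Plus_Zero Zero_closed neg_unique)

definition orth :: "'o \<Rightarrow> 'o \<Rightarrow> bool" where
  "orth A B \<longleftrightarrow> Hom C A B = {ZeroArr C A B}"

lemma orthI:
  assumes "A \<in> Obj C" "B \<in> Obj C" "\<And>f. f \<in> Hom C A B \<Longrightarrow> f = ZeroArr C A B"
  shows "orth A B"
  using assms Zero_closed unfolding orth_def by auto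

lemma orthD: "orth A B \<Longrightarrow> f \<in> Hom C A B \<Longrightarrow> f = ZeroArr C A B"
  by (simp add: orth_def)

lemma orth_Obj: "orth A B \<Longrightarrow> A \<in> Obj C \<and> B \<in> Obj C"
  by (metis Hom_Obj insertI1 orth_def)

text \<open>If \<open>Hom(Z, Z) = 0\<close> then the identity of \<open>Z\<close> vanishes, and every arrow to or from \<open>Z\<close>
  factors through it. So being a zero object is a case of orthogonality, and everything proved about
  orthogonality applies to zero objects.\<close>

lemma orth_self_imp_orth:
  assumes "orth Z Z" "A \<in> Obj C"
  shows "orth A Z" "orth Z A"
proof -
  have Z: "Z \<in> Obj C" and I: "Ident C Z = ZeroArr C Z Z"
    using assms orth_Obj orthD Ident_closed by auto
  show "orth A Z"
  proof (rule orthI[OF assms(2) Z])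
    fix f assume "f \<in> Hom C A Z"
    then show "f = ZeroArr C A Z"
      using Comp_Ident_left[of f A Z] Comp_Zero_left[of f A Z Z] I Z by simp
  qed
  show "orth Z A"
  proof (rule orthI[OF Z assms(2)])
    fix f assume "f \<in> Hom C Z A"
    then show "f = ZeroArr C Z A"
      using Comp_Ident_right[of f Z A] Comp_Zero_right[of f Z A Z] I Z by simp
  qed
qed

lemma zero_object_iff_orth: "zero_object C Z \<longleftrightarrow> orth Z Z"
proof
  assume Z: "zero_object C Z"
  then show "orth Z Z"
    by (intro orthI) (auto simp: zero_object_def intro: Zero_closed)
next
  assume Z: "orth Z Z"
  show "zero_object C Z"
    unfolding zero_object_def
    using orth_self_imp_orth[OF Z] orth_Obj[OF Z] by (auto simp: orth_def)
qed

lemma zero_orth: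
  assumes "zero_object C Z" "A \<in> Obj C"
  shows "orth A Z" "orth Z A"
  by (rule orth_self_imp_orth[OF iffD1[OF zero_object_iff_orth assms(1)] assms(2)])+

lemma zero_Obj: "zero_object C Z \<Longrightarrow> Z \<in> Obj C"
  by (simp add: zero_object_def)

lemma iso_Obj: "isomorphic C A B \<Longrightarrow> A \<in> Obj C \<and> B \<in> Obj C"
  unfolding isomorphic_def is_iso_def using Hom_Obj by blast

lemma iso_refl: "A \<in> Obj C \<Longrightarrow> isomorphic C A A"
  unfolding isomorphic_def is_iso_def using Ident_closed Comp_Ident_left by blast

lemma iso_sym: "isomorphic C A B \<Longrightarrow> isomorphic C B A"
  unfolding isomorphic_def is_iso_def by blast

lemma iso_trans:
  assumes "isomorphic C A B" "isomorphic C B D"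
  shows "isomorphic C A D"
proof -
  obtain f f' g g' where h: "f \<in> Hom C A B" "f' \<in> Hom C B A" "f' \<cdot> f = Ident C A"
    "f \<cdot> f' = Ident C B" "g \<in> Hom C B D" "g' \<in> Hom C D B" "g' \<cdot> g = Ident C B"
    "g \<cdot> g' = Ident C D"
    using assms unfolding isomorphic_def is_iso_def by blast
  have c: "g \<cdot> f \<in> Hom C A D" "f' \<cdot> g' \<in> Hom C D A"
    using h Comp_closed by blast+
  have "(f' \<cdot> g') \<cdot> (g \<cdot> f) = f' \<cdot> ((g' \<cdot> g) \<cdot> f)"
    using Comp_assoc[OF c(1) h(6,2)] Comp_assoc[OF h(1,5,6)] by simp
  then have 1: "(f' \<cdot> g') \<cdot> (g \<cdot> f) = Ident C A" using h Comp_Ident_left by simp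
  have "(g \<cdot> f) \<cdot> (f' \<cdot> g') = g \<cdot> ((f \<cdot> f') \<cdot> g')"
    using Comp_assoc[OF c(2) h(1,5)] Comp_assoc[OF h(6,2,1)] by simp
  then have 2: "(g \<cdot> f) \<cdot> (f' \<cdot> g') = Ident C D" using h Comp_Ident_left by simp
  then show ?thesis
    unfolding isomorphic_def is_iso_def using c 1 2 by blast
qed

lemma orth_iso_left:
  assumes "isomorphic C A A'" "orth A B"
  shows "orth A' B"
proof -
  obtain f g where h: "f \<in> Hom C A A'" "g \<in> Hom C A' A" "f \<cdot> g = Ident C A'"
    using assms unfolding isomorphic_def is_iso_def by blast
  show ?thesis
  proof (rule orthI)
    fix k assume k: "k \<in> Hom C A' B"
    have "k = (k \<cdot> f) \<cdot> g"
      using Comp_assoc[OF h(2,1) k] h(3) Comp_Ident_right[OF k] by simp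
    also have "k \<cdot> f = ZeroArr C A B"
      using assms(2) h k Comp_closed orthD by blast
    finally show "k = ZeroArr C A' B"
      using h k by (metis Comp_Zero_left Hom_Obj)
  qed (use h assms Hom_Obj orth_Obj in blast)+
qed

lemma orth_iso_right:
  assumes "isomorphic C B B'" "orth A B"
  shows "orth A B'"
proof -
  obtain f g where h: "f \<in> Hom C B B'" "g \<in> Hom C B' B" "f \<cdot> g = Ident C B'"
    using assms unfolding isomorphic_def is_iso_def by blast
  show ?thesis
  proof (rule orthI)
    fix k assume k: "k \<in> Hom C A B'"
    have "k = f \<cdot> (g \<cdot> k)"
      using Comp_assoc[OF k h(2,1)] h(3) Comp_Ident_left[OF k] by simp
    also have "g \<cdot> k = ZeroArr C A B"
      using assms(2) h k Comp_closed orthD by blast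
    finally show "k = ZeroArr C A B'"
      using h k by (metis Comp_Zero_right Hom_Obj)
  qed (use h assms Hom_Obj orth_Obj in blast)+
qed

lemma zero_iso: "isomorphic C A B \<Longrightarrow> zero_object C A \<Longrightarrow> zero_object C B"
  unfolding zero_object_iff_orth using orth_iso_left orth_iso_right by blast

end

section \<open>The shift functor and distinguished triangles\<close>

context triangulated_category
begin

lemma ShiftArr_closed: "f \<in> Hom C A B \<Longrightarrow> ShiftArr C f \<in> Hom C (Shift C A) (Shift C B)"
  using Shift_fully_faithful Hom_Obj by (meson bij_betwE)

lemma ShiftArr_inj:
  "f \<in> Hom C A B \<Longrightarrow> g \<in> Hom C A B \<Longrightarrow> ShiftArr C f = ShiftArr C g \<Longrightarrow> f = g"
  using Shift_fully_faithful Hom_Obj by (meson bij_betw_imp_inj_on inj_onD)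

lemma ShiftArr_surj:
  assumes "A \<in> Obj C" "B \<in> Obj C" "h \<in> Hom C (Shift C A) (Shift C B)"
  obtains f where "f \<in> Hom C A B" "ShiftArr C f = h"
  using Shift_fully_faithful[OF assms(1,2)] assms(3) by (metis bij_betw_def imageE)

lemma ShiftArr_Zero:
  assumes "A \<in> Obj C" "B \<in> Obj C"
  shows "ShiftArr C (ZeroArr C A B) = ZeroArr C (Shift C A) (Shift C B)"
  by (metis Plus_Zero Plus_self ShiftArr_Plus ShiftArr_closed Shift_closed Zero_closed assms)

lemma orth_Shift:
  assumes "A \<in> Obj C" "B \<in> Obj C"
  shows "orth (Shift C A) (Shift C B) \<longleftrightarrow> orth A B"
proof
  assume *: "orth (Shift C A) (Shift C B)"
  show "orth A B"
    by (rule orthI[OF assms])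
       (metis "*" ShiftArr_Zero ShiftArr_closed ShiftArr_inj Zero_closed assms orthD)
next
  assume *: "orth A B"
  show "orth (Shift C A) (Shift C B)"
  proof (rule orthI)
    fix f assume "f \<in> Hom C (Shift C A) (Shift C B)"
    then obtain g where "g \<in> Hom C A B" "ShiftArr C g = f"
      using assms ShiftArr_surj by blast
    then show "f = ZeroArr C (Shift C A) (Shift C B)"
      using * ShiftArr_Zero assms orthD by metis
  qed (use assms Shift_closed in auto)
qed

lemma iso_Shift:
  assumes "A \<in> Obj C" "B \<in> Obj C"
  shows "isomorphic C (Shift C A) (Shift C B) \<longleftrightarrow> isomorphic C A B"
proof
  assume "isomorphic C A B"
  then obtain f g where "f \<in> Hom C A B" "g \<in> Hom C B A" "g \<cdot> f = Ident C A" "f \<cdot> g = Ident C B"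
    unfolding isomorphic_def is_iso_def by blast
  then show "isomorphic C (Shift C A) (Shift C B)"
    unfolding isomorphic_def is_iso_def
    using ShiftArr_closed ShiftArr_Comp ShiftArr_Ident assms by metis
next
  assume "isomorphic C (Shift C A) (Shift C B)"
  then obtain f' g' where h: "f' \<in> Hom C (Shift C A) (Shift C B)"
    "g' \<in> Hom C (Shift C B) (Shift C A)"
    "g' \<cdot> f' = Ident C (Shift C A)" "f' \<cdot> g' = Ident C (Shift C B)"
    unfolding isomorphic_def is_iso_def by blast
  obtain f where f: "f \<in> Hom C A B" "ShiftArr C f = f'"
    using assms h ShiftArr_surj by blast
  obtain g where g: "g \<in> Hom C B A" "ShiftArr C g = g'"
    using assms h ShiftArr_surj by blast
  have "g \<cdot> f = Ident C A"
    by (rule ShiftArr_inj[of _ A A])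
       (use f g h assms Comp_closed Ident_closed in \<open>auto simp: ShiftArr_Comp ShiftArr_Ident\<close>)
  moreover have "f \<cdot> g = Ident C B"
    by (rule ShiftArr_inj[of _ B B])
       (use f g h assms Comp_closed Ident_closed in \<open>auto simp: ShiftArr_Comp ShiftArr_Ident\<close>)
  ultimately show "isomorphic C A B"
    unfolding isomorphic_def is_iso_def using f g by blast
qed

lemma zero_Shift: "A \<in> Obj C \<Longrightarrow> zero_object C (Shift C A) \<longleftrightarrow> zero_object C A"
  by (simp add: zero_object_iff_orth orth_Shift)

lemma dist_triangleD:
  assumes "dist_triangle C X Y Z u v w"
  shows "u \<in> Hom C X Y" "v \<in> Hom C Y Z" "w \<in> Hom C Z (Shift C X)"
    "X \<in> Obj C" "Y \<in> Obj C" "Z \<in> Obj C"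
  using assms Hom_Obj unfolding dist_triangle_def triangle_def by blast+

lemma rotate:
  "dist_triangle C X Y Z u v w \<Longrightarrow>
    dist_triangle C Y Z (Shift C X) v w (neg_arr C (ShiftArr C u))"
  using TR2[of X Y Z u v w] unfolding dist_triangle_def by blast

text \<open>Rotating this triangle forward gives the triangle \<open>W \<rightarrow> W \<rightarrow> Z[1]\<close> of an identity.\<close>

lemma dist_zero_left:
  assumes "zero_object C Z" "W \<in> Obj C"
  shows "dist_triangle C Z W W (ZeroArr C Z W) (Ident C W) (ZeroArr C W (Shift C Z))"
proof -
  have Z: "Z \<in> Obj C" "zero_object C (Shift C Z)"
    using assms zero_Shift zero_Obj by auto
  have "dist_triangle C W W (Shift C Z) (Ident C W) (ZeroArr C W (Shift C Z))
      (ZeroArr C (Shift C Z) (Shift C W))"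
    using TR1_Ident[OF assms(2) Z(2)] .
  then show ?thesis
    using Z assms
    by (subst TR2)
       (auto simp: triangle_def Zero_closed Ident_closed Shift_closed ShiftArr_Zero neg_Zero)
qed

lemma dist_comp_zero:
  assumes "dist_triangle C X Y Z u v w"
  shows "v \<cdot> u = ZeroArr C X Z"
proof -
  note d = dist_triangleD[OF assms]
  obtain N where N: "zero_object C N" using zero_object_exists by blast
  \<comment> \<open>The arrows \<open>id\<close> and \<open>u\<close> map the triangle \<open>X \<rightarrow> X \<rightarrow> 0\<close> to the given one, so \<open>v \<cdot> u\<close> factors
    through \<open>0\<close>.\<close>
  have "u \<cdot> Ident C X = u \<cdot> Ident C X" ..
  from TR3[OF TR1_Ident[OF d(4) N] assms Ident_closed[OF d(4)] d(1) this]
  obtain h where h: "h \<in> Hom C N Z" "h \<cdot> ZeroArr C X N = v \<cdot> u" by blast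
  then show ?thesis using Comp_Zero_right[OF h(1) d(4)] by simp
qed

text \<open>Exactness of \<open>Hom(W, -)\<close> at \<open>Y\<close>. The axiom that completes morphisms of triangles
  produces a third arrow, not a first one, so it is applied to the rotations
  \<open>W \<rightarrow> 0 \<rightarrow> W[1]\<close> and \<open>Y \<rightarrow> Z \<rightarrow> X[1]\<close>; the arrow found is \<open>W[1] \<rightarrow> X[1]\<close>, and full faithfulness of the
  shift brings it back.\<close>

lemma dist_lift:
  assumes "dist_triangle C X Y Z u v w" "f \<in> Hom C W Y" "v \<cdot> f = ZeroArr C W Z"
  obtains g where "g \<in> Hom C W X" "u \<cdot> g = f"
proof -
  note d = dist_triangleD[OF assms(1)]
  obtain N where N: "zero_object C N" using zero_object_exists by blast
  have W: "W \<in> Obj C" "N \<in> Obj C" using assms Hom_Obj N zero_Obj by blast+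
  have 1: "dist_triangle C W N (Shift C W) (ZeroArr C W N) (ZeroArr C N (Shift C W))
      (neg_arr C (Ident C (Shift C W)))"
    using rotate[OF TR1_Ident[OF W(1) N]] W by (simp add: ShiftArr_Ident)
  have 2: "ZeroArr C N Z \<cdot> ZeroArr C W N = v \<cdot> f"
    using assms W d by (simp add: Comp_Zero_left Zero_closed)
  obtain h where h: "h \<in> Hom C (Shift C W) (Shift C X)"
    "ShiftArr C f \<cdot> neg_arr C (Ident C (Shift C W)) = neg_arr C (ShiftArr C u) \<cdot> h"
    using TR3[OF 1 rotate[OF assms(1)] assms(2) Zero_closed[OF W(2) d(6)] 2] by blast
  obtain g where g: "g \<in> Hom C W X" "ShiftArr C g = h"
    using ShiftArr_surj h W d by blast
  note s = ShiftArr_closed[OF d(1)] ShiftArr_closed[OF assms(2)] ShiftArr_closed[OF g(1)]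
    Ident_closed[OF Shift_closed[OF W(1)]]
  have ug: "u \<cdot> g \<in> Hom C W Y" using g d Comp_closed by blast
  have "neg_arr C (ShiftArr C f) = neg_arr C (ShiftArr C (u \<cdot> g))"
    using h(2) g s d by (simp add: Comp_neg_right Comp_neg_left Comp_Ident_right ShiftArr_Comp)
  then have "ShiftArr C f = ShiftArr C (u \<cdot> g)"
    using neg_neg[OF Shift_closed[OF W(1)] Shift_closed[OF d(5)]] ShiftArr_closed[OF ug] s(2)
    by metis
  then have "u \<cdot> g = f" using ShiftArr_inj ug assms(2) by metis
  with g(1) show ?thesis using that by blast
qed

text \<open>Exactness of \<open>Hom(-, W)\<close> at \<open>Y\<close>: complete a morphism from the given triangle to
  \<open>0 \<rightarrow> W \<rightarrow> W\<close>.\<close>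

lemma dist_colift:
  assumes "dist_triangle C X Y Z u v w" "f \<in> Hom C Y W" "f \<cdot> u = ZeroArr C X W"
  obtains g where "g \<in> Hom C Z W" "g \<cdot> v = f"
proof -
  note d = dist_triangleD[OF assms(1)]
  obtain N where N: "zero_object C N" using zero_object_exists by blast
  have W: "W \<in> Obj C" "N \<in> Obj C" using assms Hom_Obj N zero_Obj by blast+
  have 2: "f \<cdot> u = ZeroArr C N W \<cdot> ZeroArr C X N"
    using assms(3) Comp_Zero_left[OF Zero_closed[OF d(4) W(2)] W(1)] by simp
  obtain h where h: "h \<in> Hom C Z W" "h \<cdot> v = Ident C W \<cdot> f"
    using TR3[OF assms(1) dist_zero_left[OF N W(1)] Zero_closed[OF d(4) W(2)] assms(2) 2] by blast
  then show ?thesis using that Comp_Ident_left[OF assms(2)] by auto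
qed

text \<open>The kernel of \<open>Hom(W, X) \<rightarrow> Hom(W, Y)\<close> comes from \<open>Hom(W, Z[-1]) = Hom(W[1], Z)\<close>. Stating the
  hypothesis with \<open>W[1]\<close> avoids negative shifts. Dually, the kernel of
  \<open>Hom(Z, W) \<rightarrow> Hom(Y, W)\<close> comes from \<open>Hom(X[1], W)\<close>.\<close>

lemma dist_mono:
  assumes D: "dist_triangle C X Y Z u v w" and o: "orth (Shift C W) Z"
    and k: "k \<in> Hom C W X" "k' \<in> Hom C W X" "u \<cdot> k = u \<cdot> k'"
  shows "k = k'"
proof -
  note d = dist_triangleD[OF D]
  have W: "W \<in> Obj C" using k Hom_Obj by blast
  define l where "l = Plus C k (neg_arr C k')"
  have n: "neg_arr C k' \<in> Hom C W X" using neg_closed W d k by blast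
  then have l: "l \<in> Hom C W X" unfolding l_def using Plus_closed W d k by blast
  have ul: "u \<cdot> l = ZeroArr C W Y"
    unfolding l_def using Comp_Plus_right[OF k(1) n d(1)] Comp_Plus_right[OF k(2) n d(1)] k(3)
      Plus_neg[OF W d(4) k(2)] Comp_Zero_right[OF d(1) W] by simp
  note s = ShiftArr_closed[OF d(1)] ShiftArr_closed[OF l]
  have "neg_arr C (ShiftArr C u) \<cdot> ShiftArr C l = ZeroArr C (Shift C W) (Shift C Y)"
    using Comp_neg_left[OF s(2,1)] ShiftArr_Comp[OF l d(1)] ul
      ShiftArr_Zero[OF W d(5)] neg_Zero[OF Shift_closed[OF W] Shift_closed[OF d(5)]] by simp
  from dist_lift[OF rotate[OF rotate[OF D]] s(2) this]
  obtain g where g: "g \<in> Hom C (Shift C W) Z" "w \<cdot> g = ShiftArr C l" by blast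
  then have "ShiftArr C l = ShiftArr C (ZeroArr C W X)"
    using orthD[OF o g(1)] d W by (simp add: ShiftArr_Zero Comp_Zero_right Shift_closed)
  then have "l = ZeroArr C W X"
    using ShiftArr_inj l Zero_closed W d by blast
  then show ?thesis using eq_if_diff_Zero W d k unfolding l_def by blast
qed

lemma dist_epi:
  assumes D: "dist_triangle C X Y Z u v w" and o: "orth (Shift C X) W"
    and k: "k \<in> Hom C Z W" "k' \<in> Hom C Z W" "k \<cdot> v = k' \<cdot> v"
  shows "k = k'"
proof -
  note d = dist_triangleD[OF D]
  have W: "W \<in> Obj C" using k Hom_Obj by blast
  define l where "l = Plus C k (neg_arr C k')"
  have n: "neg_arr C k' \<in> Hom C Z W" using neg_closed W d k by blast
  then have l: "l \<in> Hom C Z W" unfolding l_def using Plus_closed W d k by blast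
  have ul: "l \<cdot> v = ZeroArr C Y W"
    unfolding l_def using Comp_Plus_left[OF d(2) k(1) n] Comp_Plus_left[OF d(2) k(2) n] k(3)
      Plus_neg[OF d(6) W k(2)] Comp_Zero_left[OF d(2) W] by simp
  from dist_colift[OF rotate[OF D] l this]
  obtain g where g: "g \<in> Hom C (Shift C X) W" "g \<cdot> w = l" by blast
  then have "l = ZeroArr C Z W"
    using orthD[OF o g(1)] d W by (simp add: Comp_Zero_left Shift_closed)
  then show ?thesis using eq_if_diff_Zero W d k unfolding l_def by blast
qed

text \<open>Forgetting the arrows absorbs the signs that rotation introduces, and allows a triangle to be
  shifted by a negative integer.\<close>

definition tri :: "'o \<Rightarrow> 'o \<Rightarrow> 'o \<Rightarrow> bool" where
  "tri X Y Z \<longleftrightarrow> (\<exists>u v w. dist_triangle C X Y Z u v w)"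

lemma tri_Obj: "tri X Y Z \<Longrightarrow> X \<in> Obj C \<and> Y \<in> Obj C \<and> Z \<in> Obj C"
  unfolding tri_def by (blast dest: dist_triangleD)

lemma tri_rotate:
  assumes "X \<in> Obj C"
  shows "tri Y Z (Shift C X) \<longleftrightarrow> tri X Y Z"
proof
  assume "tri X Y Z" then show "tri Y Z (Shift C X)" unfolding tri_def using rotate by blast
next
  assume "tri Y Z (Shift C X)"
  then obtain v w t where D: "dist_triangle C Y Z (Shift C X) v w t"
    unfolding tri_def by blast
  note d = dist_triangleD[OF D]
  have n: "neg_arr C t \<in> Hom C (Shift C X) (Shift C Y)"
    using neg_closed d Shift_closed by blast
  then obtain u where u: "u \<in> Hom C X Y" "ShiftArr C u = neg_arr C t"
    using ShiftArr_surj assms d by blast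
  have t: "triangle C X Y Z u v w" unfolding triangle_def using u d by blast
  have "neg_arr C (ShiftArr C u) = t"
    using u neg_neg[OF d(6) Shift_closed[OF d(4)] d(3)] by simp
  then show "tri X Y Z" unfolding tri_def using TR2[OF t] D by metis
qed

lemma tri_Shift:
  assumes "X \<in> Obj C" "Y \<in> Obj C" "Z \<in> Obj C"
  shows "tri (Shift C X) (Shift C Y) (Shift C Z) \<longleftrightarrow> tri X Y Z"
  using assms tri_rotate Shift_closed by simp

lemma tri_iso:
  assumes "tri X Y Z" "isomorphic C X X'" "isomorphic C Y Y'" "isomorphic C Z Z'"
  shows "tri X' Y' Z'"
proof -
  obtain u v w where D: "dist_triangle C X Y Z u v w" using assms unfolding tri_def by blast
  note d = dist_triangleD[OF D]
  obtain f f' where f: "is_iso C X X' f" "f \<in> Hom C X X'" "f' \<in> Hom C X' X" "f' \<cdot> f = Ident C X"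
    using assms unfolding isomorphic_def is_iso_def by blast
  obtain g g' where g: "is_iso C Y Y' g" "g \<in> Hom C Y Y'" "g' \<in> Hom C Y' Y" "g' \<cdot> g = Ident C Y"
    using assms unfolding isomorphic_def is_iso_def by blast
  obtain h h' where h: "is_iso C Z Z' h" "h \<in> Hom C Z Z'" "h' \<in> Hom C Z' Z" "h' \<cdot> h = Ident C Z"
    using assms unfolding isomorphic_def is_iso_def by blast
  note sf = ShiftArr_closed[OF f(2)]
  have t: "triangle C X' Y' Z' ((g \<cdot> u) \<cdot> f') ((h \<cdot> v) \<cdot> g') ((ShiftArr C f \<cdot> w) \<cdot> h')"
    unfolding triangle_def using f(3) g(2,3) h(2,3) d(1-3) sf Comp_closed by meson
  have cancel: "(p \<cdot> q') \<cdot> q = p" if "p \<in> Hom C A B" "q \<in> Hom C A A'" "q' \<in> Hom C A' A"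
      "q' \<cdot> q = Ident C A" for p q q' A A' B
    using Comp_assoc[OF that(2,3,1)] Comp_Ident_right[OF that(1)] that(4) by simp
  have "dist_triangle C X' Y' Z' ((g \<cdot> u) \<cdot> f') ((h \<cdot> v) \<cdot> g') ((ShiftArr C f \<cdot> w) \<cdot> h')"
  proof (rule TR1_iso[OF D t f(1) g(1) h(1)])
    show "g \<cdot> u = ((g \<cdot> u) \<cdot> f') \<cdot> f" using cancel[OF Comp_closed[OF d(1) g(2)] f(2-4)] by simp
    show "h \<cdot> v = ((h \<cdot> v) \<cdot> g') \<cdot> g" using cancel[OF Comp_closed[OF d(2) h(2)] g(2-4)] by simp
    show "ShiftArr C f \<cdot> w = ((ShiftArr C f \<cdot> w) \<cdot> h') \<cdot> h" using cancel[OF Comp_closed[OF d(3) sf] h(2-4)] by simp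
  qed
  then show ?thesis unfolding tri_def by blast
qed

lemma tri_zero_right: "zero_object C Z \<Longrightarrow> X \<in> Obj C \<Longrightarrow> tri X X Z"
  unfolding tri_def using TR1_Ident by blast

lemma tri_zero_left: "zero_object C Z \<Longrightarrow> X \<in> Obj C \<Longrightarrow> tri Z X X"
  unfolding tri_def using dist_zero_left by blast

lemma orth_extension_right:
  assumes "tri X Y Z" "orth W X" "orth W Z"
  shows "orth W Y"
proof -
  obtain u v w where D: "dist_triangle C X Y Z u v w" using assms unfolding tri_def by blast
  note d = dist_triangleD[OF D]
  show ?thesis
  proof (rule orthI)
    fix f assume f: "f \<in> Hom C W Y"
    then have "v \<cdot> f = ZeroArr C W Z" using orthD[OF assms(3)] Comp_closed d by blast
    then obtain g where g: "g \<in> Hom C W X" "u \<cdot> g = f" using dist_lift D f by blast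
    then show "f = ZeroArr C W Y" using orthD[OF assms(2) g(1)] Comp_Zero_right[OF d(1)] Hom_Obj f
      by metis
  qed (use d assms orth_Obj in blast)+
qed

lemma orth_extension_left:
  assumes "tri X Y Z" "orth X W" "orth Z W"
  shows "orth Y W"
proof -
  obtain u v w where D: "dist_triangle C X Y Z u v w" using assms unfolding tri_def by blast
  note d = dist_triangleD[OF D]
  show ?thesis
  proof (rule orthI)
    fix f assume f: "f \<in> Hom C Y W"
    then have "f \<cdot> u = ZeroArr C X W" using orthD[OF assms(2)] Comp_closed d by blast
    then obtain g where g: "g \<in> Hom C Z W" "g \<cdot> v = f" using dist_colift D f by blast
    then show "f = ZeroArr C Y W" using orthD[OF assms(3) g(1)] Comp_Zero_left[OF d(2)] Hom_Obj f
      by metis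
  qed (use d assms orth_Obj in blast)+
qed

text \<open>The first two orthogonality conditions produce comparison arrows between the outer vertices.
  The last two make them unique, so their composites are identities.\<close>

lemma tri_unique:
  assumes "tri A X B" "tri A' X B'"
    and o: "orth A B'" "orth A' B" "orth (Shift C A) B" "orth (Shift C A') B'"
  shows "isomorphic C A A'" "isomorphic C B B'"
proof -
  obtain u v w where D: "dist_triangle C A X B u v w" using assms unfolding tri_def by blast
  obtain u' v' w' where D': "dist_triangle C A' X B' u' v' w'"
    using assms unfolding tri_def by blast
  note d = dist_triangleD[OF D] and d' = dist_triangleD[OF D']
  have vu: "v' \<cdot> u = ZeroArr C A B'" "v \<cdot> u' = ZeroArr C A' B"
    using orthD o Comp_closed d d' by blast+
  obtain f where f: "f \<in> Hom C A A'" "u' \<cdot> f = u" using dist_lift[OF D' d(1) vu(1)] by blast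
  obtain f' where f': "f' \<in> Hom C A' A" "u \<cdot> f' = u'" using dist_lift[OF D d'(1) vu(2)] by blast
  have "f' \<cdot> f = Ident C A"
  proof (rule dist_mono[OF D o(3)])
    show "u \<cdot> (f' \<cdot> f) = u \<cdot> Ident C A"
      using f f' d Comp_assoc[OF f(1) f'(1) d(1)] Comp_Ident_right by simp
  qed (use f f' Comp_closed Ident_closed d in blast)+
  moreover have "f \<cdot> f' = Ident C A'"
  proof (rule dist_mono[OF D' o(4)])
    show "u' \<cdot> (f \<cdot> f') = u' \<cdot> Ident C A'"
      using f f' d' Comp_assoc[OF f'(1) f(1) d'(1)] Comp_Ident_right by simp
  qed (use f f' Comp_closed Ident_closed d' in blast)+
  ultimately show "isomorphic C A A'"
    unfolding isomorphic_def is_iso_def using f f' by blast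
  obtain g where g: "g \<in> Hom C B B'" "g \<cdot> v = v'" using dist_colift[OF D d'(2) vu(1)] by blast
  obtain g' where g': "g' \<in> Hom C B' B" "g' \<cdot> v' = v" using dist_colift[OF D' d(2) vu(2)] by blast
  have "g' \<cdot> g = Ident C B"
  proof (rule dist_epi[OF D o(3)])
    show "(g' \<cdot> g) \<cdot> v = Ident C B \<cdot> v"
      using g g' d Comp_assoc[OF d(2) g(1) g'(1)] Comp_Ident_left by simp
  qed (use g g' Comp_closed Ident_closed d in blast)+
  moreover have "g \<cdot> g' = Ident C B'"
  proof (rule dist_epi[OF D' o(4)])
    show "(g \<cdot> g') \<cdot> v' = Ident C B' \<cdot> v'"
      using g g' d' Comp_assoc[OF d'(2) g'(1) g(1)] Comp_Ident_left by simp
  qed (use g g' Comp_closed Ident_closed d' in blast)+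
  ultimately show "isomorphic C B B'"
    unfolding isomorphic_def is_iso_def using g g' by blast
qed

section \<open>Integral shifts of objects\<close>

lemma Shift_pow_closed: "A \<in> Obj C \<Longrightarrow> (Shift C ^^ n) A \<in> Obj C"
  by (induction n) (auto simp: Shift_closed)

lemma iso_Shift_pow:
  assumes "A \<in> Obj C" "B \<in> Obj C"
  shows "isomorphic C ((Shift C ^^ n) A) ((Shift C ^^ n) B) \<longleftrightarrow> isomorphic C A B"
  using assms by (induction n) (auto simp: iso_Shift Shift_pow_closed)

lemma orth_Shift_pow:
  assumes "A \<in> Obj C" "B \<in> Obj C"
  shows "orth ((Shift C ^^ n) A) ((Shift C ^^ n) B) \<longleftrightarrow> orth A B"
  using assms by (induction n) (auto simp: orth_Shift Shift_pow_closed)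

lemma tri_Shift_pow:
  assumes "X \<in> Obj C" "Y \<in> Obj C" "Z \<in> Obj C"
  shows "tri ((Shift C ^^ n) X) ((Shift C ^^ n) Y) ((Shift C ^^ n) Z) \<longleftrightarrow> tri X Y Z"
  using assms by (induction n) (auto simp: tri_Shift Shift_pow_closed)

lemma Shift_pow_ess_surj:
  assumes "A \<in> Obj C"
  shows "\<exists>B \<in> Obj C. isomorphic C ((Shift C ^^ n) B) A"
  using assms
proof (induction n arbitrary: A)
  case 0
  then show ?case using iso_refl by auto
next
  case (Suc n)
  obtain B where B: "B \<in> Obj C" "isomorphic C (Shift C B) A" using Shift_ess_surj Suc by blast
  obtain D where D: "D \<in> Obj C" "isomorphic C ((Shift C ^^ n) D) B" using Suc B by blast
  have "isomorphic C (Shift C ((Shift C ^^ n) D)) (Shift C B)"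
    using iso_Shift Shift_pow_closed B D by blast
  then show ?case using B D iso_trans by auto
qed

lemma shift_obj_negative:
  assumes "X \<in> Obj C" "i < 0"
  shows "shift_obj C i X \<in> Obj C \<and> isomorphic C ((Shift C ^^ nat (- i)) (shift_obj C i X)) X"
  using someI_ex[OF Shift_pow_ess_surj[OF assms(1), of "nat (- i)", unfolded Bex_def]] assms(2)
  by (simp add: shift_obj_def)

lemma shift_obj_closed: "X \<in> Obj C \<Longrightarrow> shift_obj C i X \<in> Obj C"
  using shift_obj_negative by (cases "i < 0") (auto simp: shift_obj_def Shift_pow_closed)

text \<open>Negative shifts are chosen up to isomorphism and do not form a functor. Applying a large
  positive power of the shift turns them into positive shifts, and such a power reflects
  isomorphisms, orthogonality and triangles.\<close>

lemma Shift_pow_shift_obj: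
  assumes "X \<in> Obj C" "int n + i \<ge> 0"
  shows "isomorphic C ((Shift C ^^ n) (shift_obj C i X)) ((Shift C ^^ nat (int n + i)) X)"
proof (cases "i < 0")
  case True
  have n: "n = nat (int n + i) + nat (- i)" using assms True by linarith
  have "isomorphic C ((Shift C ^^ nat (- i)) (shift_obj C i X)) X"
    using shift_obj_negative True assms by blast
  then have "isomorphic C ((Shift C ^^ nat (int n + i)) ((Shift C ^^ nat (- i)) (shift_obj C i X)))
      ((Shift C ^^ nat (int n + i)) X)"
    using iso_Shift_pow Shift_pow_closed shift_obj_closed assms by blast
  then show ?thesis by (subst n) (simp add: funpow_add)
next
  case False
  then have "nat (int n + i) = n + nat i" by linarith
  then show ?thesis
    using False assms by (simp add: shift_obj_def funpow_add iso_refl Shift_pow_closed)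
qed

lemma shift_obj_as_Shift_pow:
  obtains n m where
    "\<And>X. X \<in> Obj C \<Longrightarrow> isomorphic C ((Shift C ^^ m) X) ((Shift C ^^ n) (shift_obj C i X))"
proof -
  define n where "n = nat (- i)"
  have "int n + i \<ge> 0" by (simp add: n_def)
  then show ?thesis using that iso_sym[OF Shift_pow_shift_obj] by blast
qed

lemma shift_obj_add:
  assumes "X \<in> Obj C"
  shows "isomorphic C (shift_obj C i (shift_obj C j X)) (shift_obj C (i + j) X)"
proof -
  define n where "n = nat (\<bar>i\<bar> + \<bar>j\<bar>)"
  define m where "m = nat (int n + i)"
  have le: "int n + i \<ge> 0" "int m + j \<ge> 0" "int n + (i + j) \<ge> 0"
    and m: "int m + j = int n + (i + j)"
    unfolding n_def m_def by linarith+
  note cl = assms shift_obj_closed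
  have "isomorphic C ((Shift C ^^ n) (shift_obj C i (shift_obj C j X)))
      ((Shift C ^^ m) (shift_obj C j X))"
    unfolding m_def by (intro Shift_pow_shift_obj le cl)
  moreover have "isomorphic C ((Shift C ^^ m) (shift_obj C j X)) ((Shift C ^^ nat (int m + j)) X)"
    by (intro Shift_pow_shift_obj le cl)
  moreover have "isomorphic C ((Shift C ^^ nat (int m + j)) X)
      ((Shift C ^^ n) (shift_obj C (i + j) X))"
    unfolding m by (intro iso_sym[OF Shift_pow_shift_obj] le cl)
  ultimately have "isomorphic C ((Shift C ^^ n) (shift_obj C i (shift_obj C j X)))
      ((Shift C ^^ n) (shift_obj C (i + j) X))"
    using iso_trans by blast
  then show ?thesis using iso_Shift_pow cl by blast
qed

lemma shift_obj_0: "shift_obj C 0 X = X"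
  by (simp add: shift_obj_def)

lemma shift_obj_1: "shift_obj C 1 X = Shift C X"
  by (simp add: shift_obj_def)

lemma iso_shift_obj: "isomorphic C X Y \<Longrightarrow> isomorphic C (shift_obj C i X) (shift_obj C i Y)"
proof -
  assume a: "isomorphic C X Y"
  then have o: "X \<in> Obj C" "Y \<in> Obj C" using iso_Obj by auto
  obtain n m where
    nm: "\<And>X. X \<in> Obj C \<Longrightarrow> isomorphic C ((Shift C ^^ m) X) ((Shift C ^^ n) (shift_obj C i X))"
    using shift_obj_as_Shift_pow[of i] by blast
  have "isomorphic C ((Shift C ^^ m) X) ((Shift C ^^ m) Y)" using a o iso_Shift_pow by blast
  then have "isomorphic C ((Shift C ^^ n) (shift_obj C i X)) ((Shift C ^^ n) (shift_obj C i Y))"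
    using iso_trans[OF iso_sym[OF nm[OF o(1)]] iso_trans[OF _ nm[OF o(2)]]] by blast
  then show ?thesis using iso_Shift_pow o shift_obj_closed by blast
qed

lemma orth_shift_obj: "orth A B \<Longrightarrow> orth (shift_obj C i A) (shift_obj C i B)"
proof -
  assume a: "orth A B"
  then have o: "A \<in> Obj C" "B \<in> Obj C" using orth_Obj by auto
  obtain n m where
    nm: "\<And>X. X \<in> Obj C \<Longrightarrow> isomorphic C ((Shift C ^^ m) X) ((Shift C ^^ n) (shift_obj C i X))"
    using shift_obj_as_Shift_pow[of i] by blast
  have "orth ((Shift C ^^ m) A) ((Shift C ^^ m) B)" using a o orth_Shift_pow by blast
  then have "orth ((Shift C ^^ n) (shift_obj C i A)) ((Shift C ^^ n) (shift_obj C i B))"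
    using orth_iso_left[OF nm[OF o(1)] orth_iso_right[OF nm[OF o(2)]]] by blast
  then show ?thesis using orth_Shift_pow o shift_obj_closed by blast
qed

lemma tri_shift_obj:
  "tri X Y Z \<Longrightarrow> tri (shift_obj C i X) (shift_obj C i Y) (shift_obj C i Z)"
proof -
  assume a: "tri X Y Z"
  then have o: "X \<in> Obj C" "Y \<in> Obj C" "Z \<in> Obj C" using tri_Obj by auto
  obtain n m where
    nm: "\<And>X. X \<in> Obj C \<Longrightarrow> isomorphic C ((Shift C ^^ m) X) ((Shift C ^^ n) (shift_obj C i X))"
    using shift_obj_as_Shift_pow[of i] by blast
  have "tri ((Shift C ^^ m) X) ((Shift C ^^ m) Y) ((Shift C ^^ m) Z)"
    using a o tri_Shift_pow by blast
  then have "tri ((Shift C ^^ n) (shift_obj C i X)) ((Shift C ^^ n) (shift_obj C i Y))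
      ((Shift C ^^ n) (shift_obj C i Z))"
    using tri_iso[OF _ nm[OF o(1)] nm[OF o(2)] nm[OF o(3)]] by blast
  then show ?thesis using tri_Shift_pow o shift_obj_closed by blast
qed

lemma zero_shift_obj: "zero_object C X \<Longrightarrow> zero_object C (shift_obj C i X)"
  by (simp add: zero_object_iff_orth orth_shift_obj)

section \<open>Aisles, co-aisles and truncations\<close>

lemma mem_shift_class:
  assumes "full_subcategory C S"
  shows "X \<in> shift_class C (- i) S \<longleftrightarrow> X \<in> Obj C \<and> shift_obj C i X \<in> S"
proof -
  have S: "S \<subseteq> Obj C" and iso: "\<And>A B. A \<in> S \<Longrightarrow> isomorphic C A B \<Longrightarrow> B \<in> S"
    using assms iso_Obj unfolding full_subcategory_def by blast+
  have inverse: "isomorphic C (shift_obj C (- j) (shift_obj C j Y)) Y" if "Y \<in> Obj C" for j Y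
    using shift_obj_add[OF that, of "- j" j] by (simp add: shift_obj_0)
  show ?thesis
  proof
    assume "X \<in> shift_class C (- i) S"
    then obtain Y where Y: "Y \<in> S" "X \<in> Obj C" "isomorphic C X (shift_obj C (- i) Y)"
      unfolding shift_class_def by blast
    then have "isomorphic C (shift_obj C i X) Y"
      using iso_shift_obj[OF Y(3), of i] inverse[of Y "- i"] S iso_trans by auto
    then show "X \<in> Obj C \<and> shift_obj C i X \<in> S" using Y iso iso_sym by blast
  next
    assume "X \<in> Obj C \<and> shift_obj C i X \<in> S"
    then show "X \<in> shift_class C (- i) S"
      unfolding shift_class_def using inverse iso_sym by blast
  qed
qed

lemma full_subcategory_closure:
  assumes "full_subcategory C S"
  shows "X \<in> S \<Longrightarrow> X \<in> Obj C" "X \<in> S \<Longrightarrow> isomorphic C X Y \<Longrightarrow> Y \<in> S"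
    "zero_object C X \<Longrightarrow> X \<in> S"
  using assms iso_Obj unfolding full_subcategory_def by blast+

end

text \<open>Below, \<open>le i\<close> and \<open>ge i\<close> stand for \<open>E\<^bsup>\<le>i\<^esup>\<close> and \<open>E\<^bsup>\<ge>i\<^esup>\<close>.\<close>

locale category_with_t_structure = triangulated_category C
  for C :: "('o, 'm, 'z) triangulated_category_scheme" (structure) +
  fixes E :: "'o tstr"
  assumes t_structure: "t_structure C E"
begin

abbreviation le :: "int \<Rightarrow> 'o set" where "le \<equiv> le_part C E"
abbreviation ge :: "int \<Rightarrow> 'o set" where "ge \<equiv> ge_part C E"

lemma aisle_full: "full_subcategory C (aisle E)"
  and coaisle_full: "full_subcategory C (coaisle E)"
  using t_structure unfolding t_structure_def by blast+

lemma mem_le: "X \<in> le i \<longleftrightarrow> X \<in> Obj C \<and> shift_obj C i X \<in> aisle E"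
  unfolding le_part_def by (rule mem_shift_class[OF aisle_full])

lemma mem_ge: "X \<in> ge i \<longleftrightarrow> X \<in> Obj C \<and> shift_obj C i X \<in> coaisle E"
  unfolding ge_part_def by (rule mem_shift_class[OF coaisle_full])

lemma le_0: "le 0 = aisle E"
  using full_subcategory_closure(1)[OF aisle_full] by (auto simp: mem_le shift_obj_0)

lemma ge_0: "ge 0 = coaisle E"
  using full_subcategory_closure(1)[OF coaisle_full] by (auto simp: mem_ge shift_obj_0)

lemma le_Obj: "X \<in> le i \<Longrightarrow> X \<in> Obj C" and ge_Obj: "X \<in> ge i \<Longrightarrow> X \<in> Obj C"
  by (simp_all add: mem_le mem_ge)

lemma le_iso: "X \<in> le i \<Longrightarrow> isomorphic C X Y \<Longrightarrow> Y \<in> le i"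
  using full_subcategory_closure(2)[OF aisle_full] iso_shift_obj iso_Obj by (meson mem_le)

lemma ge_iso: "X \<in> ge i \<Longrightarrow> isomorphic C X Y \<Longrightarrow> Y \<in> ge i"
  using full_subcategory_closure(2)[OF coaisle_full] iso_shift_obj iso_Obj by (meson mem_ge)

lemma zero_le: "zero_object C X \<Longrightarrow> X \<in> le i"
  using full_subcategory_closure(3)[OF aisle_full] zero_shift_obj zero_Obj by (simp add: mem_le)

lemma zero_ge: "zero_object C X \<Longrightarrow> X \<in> ge i"
  using full_subcategory_closure(3)[OF coaisle_full] zero_shift_obj zero_Obj by (simp add: mem_ge)

lemma shift_le: "X \<in> Obj C \<Longrightarrow> shift_obj C j X \<in> le i \<longleftrightarrow> X \<in> le (i + j)"
  using full_subcategory_closure(2)[OF aisle_full] shift_obj_add iso_sym shift_obj_closed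
  by (meson mem_le)

lemma shift_ge: "X \<in> Obj C \<Longrightarrow> shift_obj C j X \<in> ge i \<longleftrightarrow> X \<in> ge (i + j)"
  using full_subcategory_closure(2)[OF coaisle_full] shift_obj_add iso_sym shift_obj_closed
  by (meson mem_ge)

lemma Shift_le: "X \<in> Obj C \<Longrightarrow> Shift C X \<in> le i \<longleftrightarrow> X \<in> le (i + 1)"
  using shift_le[of X 1 i] by (simp add: shift_obj_1)

lemma Shift_ge: "X \<in> Obj C \<Longrightarrow> Shift C X \<in> ge i \<longleftrightarrow> X \<in> ge (i + 1)"
  using shift_ge[of X 1 i] by (simp add: shift_obj_1)

lemma le_mono:
  assumes "i \<le> j"
  shows "le i \<subseteq> le j"
  using assms
proof (induction j rule: int_ge_induct)
  case (step j)
  have "aisle E \<subseteq> le 1" using t_structure unfolding t_structure_def by blast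
  then have "le j \<subseteq> le (j + 1)"
    using shift_le[of _ j 1] by (auto simp: mem_le[of _ j] add.commute)
  then show ?case using step by blast
qed simp

lemma ge_mono:
  assumes "i \<le> j"
  shows "ge j \<subseteq> ge i"
  using assms
proof (induction j rule: int_ge_induct)
  case (step j)
  have "ge 1 \<subseteq> coaisle E" using t_structure unfolding t_structure_def by blast
  then have "X \<in> ge j" if "X \<in> ge (j + 1)" for X
    using that shift_ge[of X j 1] ge_Obj[OF that] by (auto simp: mem_ge[of _ j] add.commute)
  then show ?case using step by blast
qed simp

lemma orth_le_ge:
  assumes "A \<in> le i" "B \<in> ge j" "i < j"
  shows "orth A B"
proof -
  have B: "B \<in> Obj C" and A: "A \<in> Obj C" using assms le_Obj ge_Obj by auto
  have "B \<in> ge (1 + i)" using assms ge_mono[of "1 + i" j] by auto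
  then have "shift_obj C i B \<in> ge 1" using shift_ge B by blast
  moreover have "shift_obj C i A \<in> aisle E" using assms mem_le by blast
  ultimately have "orth (shift_obj C i A) (shift_obj C i B)"
    using t_structure unfolding t_structure_def orth_def by blast
  then have "orth (shift_obj C (- i) (shift_obj C i A)) (shift_obj C (- i) (shift_obj C i B))"
    by (rule orth_shift_obj)
  then show ?thesis
    using orth_iso_left[OF shift_obj_add[OF A, of "- i" i]
        orth_iso_right[OF shift_obj_add[OF B, of "- i" i]]]
    by (simp add: shift_obj_0)
qed

lemma truncation:
  assumes "X \<in> Obj C"
  obtains A B where "A \<in> le i" "B \<in> ge (i + 1)" "tri A X B"
proof -
  obtain A B where AB: "A \<in> aisle E" "B \<in> ge 1" "tri A (shift_obj C i X) B"
    using t_structure shift_obj_closed[OF assms, of i] unfolding t_structure_def tri_def by blast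
  have o: "A \<in> Obj C" "B \<in> Obj C" using AB tri_Obj by auto
  have "tri (shift_obj C (- i) A) (shift_obj C (- i) (shift_obj C i X)) (shift_obj C (- i) B)"
    using AB tri_shift_obj by blast
  then have "tri (shift_obj C (- i) A) X (shift_obj C (- i) B)"
    using tri_iso shift_obj_add[OF assms, of "- i" i] iso_refl shift_obj_closed o
    by (simp add: shift_obj_0)
  moreover have "shift_obj C (- i) A \<in> le i" "shift_obj C (- i) B \<in> ge (i + 1)"
    using AB o shift_le[of A "- i" i] shift_ge[of B "- i" "i + 1"] by (auto simp: le_0)
  ultimately show ?thesis using that by blast
qed

lemma Shift_le_self: "X \<in> le i \<Longrightarrow> Shift C X \<in> le i"
  using le_mono[of i "i + 1"] Shift_le[of X i] le_Obj[of X i] by auto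

lemma truncation_unique:
  assumes t: "tri A X B" "tri A' X B'"
    and A: "A \<in> le i" "A' \<in> le i" and B: "B \<in> ge (i + 1)" "B' \<in> ge (i + 1)"
  shows "isomorphic C A A'" "isomorphic C B B'"
proof -
  have o: "orth Y Z" if "Y \<in> le i" "Z \<in> ge (i + 1)" for Y Z
    using that by (rule orth_le_ge) simp
  show "isomorphic C A A'" "isomorphic C B B'"
    by (rule tri_unique[OF t]; intro o Shift_le_self A B)+
qed

text \<open>Aisle and co-aisle determine each other as orthogonals. If \<open>X\<close> is orthogonal to the co-aisle,
  its truncation triangle \<open>A \<rightarrow> X \<rightarrow> B\<close> satisfies the conditions that make it isomorphic to
  \<open>X \<rightarrow> X \<rightarrow> 0\<close>, hence \<open>X\<close> is isomorphic to \<open>A\<close>.\<close>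

lemma le_iff_orth: "X \<in> le i \<longleftrightarrow> X \<in> Obj C \<and> (\<forall>B \<in> ge (i + 1). orth X B)"
proof (intro iffI conjI ballI)
  assume X: "X \<in> Obj C \<and> (\<forall>B \<in> ge (i + 1). orth X B)"
  then have XO: "X \<in> Obj C" by blast
  obtain A B where AB: "A \<in> le i" "B \<in> ge (i + 1)" "tri A X B" using truncation[OF XO] .
  obtain Z where Z: "zero_object C Z" using zero_object_exists by blast
  have "isomorphic C A X"
  proof (rule tri_unique(1)[OF AB(3) tri_zero_right[OF Z XO]])
    show "orth A Z" using zero_orth(1)[OF Z] AB(1) le_Obj by blast
    show "orth X B" using X AB by blast
    show "orth (Shift C A) B" using orth_le_ge[OF Shift_le_self[OF AB(1)] AB(2)] by simp
    show "orth (Shift C X) Z" using zero_orth(1)[OF Z] Shift_closed[OF XO] .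
  qed
  then show "X \<in> le i" using AB le_iso by blast
qed (auto intro: orth_le_ge dest: le_Obj)

lemma ge_iff_orth: "X \<in> ge (i + 1) \<longleftrightarrow> X \<in> Obj C \<and> (\<forall>A \<in> le i. orth A X)"
proof (intro iffI conjI ballI)
  assume X: "X \<in> Obj C \<and> (\<forall>A \<in> le i. orth A X)"
  then have XO: "X \<in> Obj C" by blast
  obtain A B where AB: "A \<in> le i" "B \<in> ge (i + 1)" "tri A X B" using truncation[OF XO] .
  obtain Z where Z: "zero_object C Z" using zero_object_exists by blast
  have "isomorphic C B X"
  proof (rule tri_unique(2)[OF AB(3) tri_zero_left[OF Z XO]])
    show "orth A X" using X AB by blast
    show "orth Z B" using zero_orth(2)[OF Z] AB(2) ge_Obj by blast
    show "orth (Shift C A) B" using orth_le_ge[OF Shift_le_self[OF AB(1)] AB(2)] by simp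
    show "orth (Shift C Z) X"
      using zero_orth(2)[of "Shift C Z" X] zero_Shift[OF zero_Obj[OF Z]] Z XO by blast
  qed
  then show "X \<in> ge (i + 1)" using AB ge_iso by blast
qed (auto intro: orth_le_ge dest: ge_Obj)

lemma le_extension: "tri X Y Z \<Longrightarrow> X \<in> le i \<Longrightarrow> Z \<in> le i \<Longrightarrow> Y \<in> le i"
  using le_iff_orth orth_extension_left tri_Obj by blast

lemma ge_extension:
  assumes "tri X Y Z" "X \<in> ge i" "Z \<in> ge i"
  shows "Y \<in> ge i"
proof -
  obtain j where i: "i = j + 1" by (metis diff_add_cancel)
  then show ?thesis using assms ge_iff_orth orth_extension_right tri_Obj by blast
qed

lemma le_cone:
  assumes t: "tri X Y Z" and X: "X \<in> le (i + 1)" and Y: "Y \<in> le i"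
  shows "Z \<in> le i"
proof (rule le_extension)
  show "tri Y Z (Shift C X)" using t tri_rotate le_Obj[OF X] by blast
  show "Shift C X \<in> le i" using X Shift_le le_Obj[OF X] by blast
qed (rule Y)

lemma ge_cocone:
  assumes t: "tri X Y Z" and Y: "Y \<in> ge i" and Z: "Z \<in> ge (i - 1)"
  shows "X \<in> ge i"
proof -
  have o: "X \<in> Obj C" "Y \<in> Obj C" using tri_Obj[OF t] by auto
  have "tri Y Z (Shift C X)" using t tri_rotate[OF o(1)] by blast
  then have "tri Z (Shift C X) (Shift C Y)" using tri_rotate[OF o(2)] by blast
  moreover have "Shift C Y \<in> ge (i - 1)" using Y Shift_ge[OF o(2), of "i - 1"] by simp
  ultimately have "Shift C X \<in> ge (i - 1)" using Z ge_extension by blast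
  then show ?thesis using Shift_ge[OF o(1), of "i - 1"] by simp
qed

lemma zero_if_le_ge: "X \<in> le i \<Longrightarrow> X \<in> ge j \<Longrightarrow> i < j \<Longrightarrow> zero_object C X"
  by (simp add: zero_object_iff_orth orth_le_ge)

lemma zero_if_all_le:
  assumes "\<And>i. X \<in> le i"
  shows "zero_object C X"
proof -
  have "(\<Inter>i. le i) = {Z. zero_object C Z}"
    using t_structure by (simp add: t_structure_def non_degenerate_def)
  moreover have "X \<in> (\<Inter>i. le i)" using assms by simp
  ultimately show ?thesis by simp
qed

lemma zero_if_all_ge:
  assumes "\<And>i. X \<in> ge i"
  shows "zero_object C X"
proof -
  have "(\<Inter>i. ge i) = {Z. zero_object C Z}"
    using t_structure by (simp add: t_structure_def non_degenerate_def)
  moreover have "X \<in> (\<Inter>i. ge i)" using assms by simp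
  ultimately show ?thesis by simp
qed

section \<open>Cohomology detects aisles and co-aisles\<close>

text \<open>The chosen truncations are known only through the triangles that they sit in.\<close>

lemma cohomology_triangles:
  assumes "X \<in> Obj C"
  obtains A B A' where "A \<in> le 0" "B \<in> ge 1" "tri A (shift_obj C i X) B"
    "A' \<in> le (- 1)" "tri A' A (cohomology C E i X)" "cohomology C E i X \<in> ge 0"
proof -
  let ?S = "shift_obj C i X" and ?H = "cohomology C E i X"
  have "\<exists>A. A \<in> aisle E \<and> (\<exists>B \<in> ge 1. \<exists>u v w. dist_triangle C A ?S B u v w)"
    using t_structure shift_obj_closed[OF assms, of i] unfolding t_structure_def by blast
  from someI_ex[OF this] obtain B where A: "trunc_le C E ?S \<in> le 0" and B: "B \<in> ge 1"
    and t: "tri (trunc_le C E ?S) ?S B"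
    unfolding trunc_le_def tri_def le_0 by blast
  obtain A2 B2 where "A2 \<in> le (- 1)" "B2 \<in> ge (- 1 + 1)" "tri A2 (trunc_le C E ?S) B2"
    using truncation[OF le_Obj[OF A]] .
  then have "A2 \<in> le (- 1)" "B2 \<in> coaisle E" "tri A2 (trunc_le C E ?S) B2"
    by (simp_all add: ge_0)
  then have "\<exists>B. B \<in> coaisle E \<and>
      (\<exists>A' \<in> le (- 1). \<exists>u v w. dist_triangle C A' (trunc_le C E ?S) B u v w)"
    unfolding tri_def by blast
  from someI_ex[OF this] obtain A' where "?H \<in> ge 0" and "A' \<in> le (- 1)"
    and "tri A' (trunc_le C E ?S) ?H"
    unfolding cohomology_def trunc_ge_def tri_def ge_0 by blast
  then show ?thesis using that A B t by blast
qed

text \<open>Shifting back by \<open>-i\<close> compares \<open>H\<^sup>i(X)[-i]\<close> with the truncations of \<open>X\<close> itself: it is the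
  cone of \<open>\<tau>\<^bsup>\<le>i-1\<^esup> X \<rightarrow> \<tau>\<^bsup>\<le>i\<^esup> X\<close>.\<close>

lemma cohomology_truncations:
  assumes "X \<in> Obj C"
  obtains A B A' where "A \<in> le i" "B \<in> ge (i + 1)" "tri A X B"
    "A' \<in> le (i - 1)" "tri A' A (shift_obj C (- i) (cohomology C E i X))"
    "shift_obj C (- i) (cohomology C E i X) \<in> ge i"
proof -
  let ?H = "cohomology C E i X" and ?s = "shift_obj C (- i)"
  obtain A B A' where h: "A \<in> le 0" "B \<in> ge 1" "tri A (shift_obj C i X) B"
    "A' \<in> le (- 1)" "tri A' A ?H" "?H \<in> ge 0"
    using cohomology_triangles[OF assms] .
  have o: "A \<in> Obj C" "B \<in> Obj C" "A' \<in> Obj C" "?H \<in> Obj C"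
    using tri_Obj[OF h(3)] tri_Obj[OF h(5)] by auto
  have "tri (?s A) X (?s B)"
    using tri_iso[OF tri_shift_obj[OF h(3), of "- i"] iso_refl
        shift_obj_add[OF assms, of "- i" i] iso_refl] shift_obj_closed o
    by (simp add: shift_obj_0)
  moreover have "tri (?s A') (?s A) (?s ?H)" using tri_shift_obj h by blast
  moreover have "?s A \<in> le i" "?s B \<in> ge (i + 1)" "?s A' \<in> le (i - 1)" "?s ?H \<in> ge i"
    using h o by (simp_all add: shift_le shift_ge)
  ultimately show ?thesis using that by blast
qed

lemma cohomology_heart:
  assumes "X \<in> Obj C"
  shows "cohomology C E i X \<in> heart_objects E"
proof -
  let ?H = "cohomology C E i X"
  obtain A B A' where h: "A \<in> le 0" "B \<in> ge 1" "tri A (shift_obj C i X) B"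
    "A' \<in> le (- 1)" "tri A' A ?H" "?H \<in> ge 0"
    using cohomology_triangles[OF assms] .
  have "A' \<in> le (0 + 1)" using h le_mono[of "- 1" "0 + 1"] by auto
  then have "?H \<in> le 0" using le_cone[OF h(5)] h by blast
  then show ?thesis using h by (simp add: heart_objects_def le_0 ge_0)
qed

lemma cohomology_Obj: "X \<in> Obj C \<Longrightarrow> cohomology C E i X \<in> Obj C"
  using cohomology_heart full_subcategory_closure(1)[OF aisle_full]
  by (auto simp: heart_objects_def)

text \<open>As \<open>H\<^sup>i(X)[-i]\<close> is the cone of \<open>\<tau>\<^bsup>\<le>i-1\<^esup> X \<rightarrow> \<tau>\<^bsup>\<le>i\<^esup> X\<close>, it vanishes exactly when the
  two truncations agree.\<close>

lemma zero_cohomology_iff: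
  assumes "tri A X B" "A \<in> le i" "B \<in> ge (i + 1)"
  shows "zero_object C (cohomology C E i X) \<longleftrightarrow> A \<in> le (i - 1)"
proof -
  let ?H = "cohomology C E i X"
  have X: "X \<in> Obj C" using assms tri_Obj by blast
  obtain A1 B1 A' where h: "A1 \<in> le i" "B1 \<in> ge (i + 1)" "tri A1 X B1"
    "A' \<in> le (i - 1)" "tri A' A1 (shift_obj C (- i) ?H)" "shift_obj C (- i) ?H \<in> ge i"
    using cohomology_truncations[OF X] .
  have iso: "isomorphic C A A1" using truncation_unique(1)[OF assms(1) h(3)] assms h by blast
  show ?thesis
  proof
    assume "zero_object C ?H"
    then have "A1 \<in> le (i - 1)" using le_extension h zero_le zero_shift_obj by blast
    then show "A \<in> le (i - 1)" using iso le_iso iso_sym by blast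
  next
    assume "A \<in> le (i - 1)"
    then have "A1 \<in> le (i - 1)" using iso le_iso by blast
    moreover have "A' \<in> le ((i - 1) + 1)" using h(4) le_mono[of "i - 1" "i - 1 + 1"] by auto
    ultimately have "shift_obj C (- i) ?H \<in> le (i - 1)" using le_cone h by blast
    then have "zero_object C (shift_obj C (- i) ?H)" using zero_if_le_ge[OF _ h(6)] by auto
    then have "zero_object C (shift_obj C i (shift_obj C (- i) ?H))" by (rule zero_shift_obj)
    then show "zero_object C ?H"
      using zero_iso shift_obj_add[OF cohomology_Obj[OF X], of i "- i"]
      by (simp add: shift_obj_0) blast
  qed
qed

text \<open>If all cohomology above \<open>k\<close> vanishes, truncating at \<open>k\<close> gives the same triangle as truncating
  at any larger degree. So \<open>\<tau>\<^bsup>>k\<^esup> X\<close> lies in \<open>E\<^bsup>\<ge>j\<^esup>\<close> for all \<open>j\<close>, and it is zero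
  by non-degeneracy.\<close>

lemma le_iff_cohomology:
  assumes X: "X \<in> Obj C"
  shows "X \<in> le k \<longleftrightarrow> (\<forall>i > k. zero_object C (cohomology C E i X))"
proof (intro iffI allI impI)
  fix i assume "X \<in> le k" "i > k"
  then have "X \<in> le i" "X \<in> le (i - 1)" using le_mono[of k i] le_mono[of k "i - 1"] by auto
  moreover obtain Z where "zero_object C Z" using zero_object_exists by blast
  ultimately show "zero_object C (cohomology C E i X)"
    using zero_cohomology_iff[OF tri_zero_right] zero_ge X by blast
next
  assume zero: "\<forall>i > k. zero_object C (cohomology C E i X)"
  obtain A B where AB: "A \<in> le k" "B \<in> ge (k + 1)" "tri A X B" using truncation X by blast
  have "B \<in> ge j" if "j \<ge> k + 1" for j
    using that
  proof (induction j rule: int_ge_induct)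
    case (step j)
    obtain A1 B1 where h: "A1 \<in> le j" "B1 \<in> ge (j + 1)" "tri A1 X B1" using truncation X by blast
    have "zero_object C (cohomology C E j X)" using zero step by auto
    then have "A1 \<in> le (j - 1)" using zero_cohomology_iff h by blast
    moreover have "A \<in> le (j - 1)" using AB le_mono[of k "j - 1"] step by auto
    moreover have "B1 \<in> ge (j - 1 + 1)" using h ge_mono[of j "j + 1"] by auto
    moreover have "B \<in> ge (j - 1 + 1)" using step by simp
    ultimately have "isomorphic C B1 B" using truncation_unique(2)[OF h(3) AB(3)] by blast
    then show ?case using h ge_iso by blast
  qed (use AB in blast)
  then have "B \<in> ge j" for j using ge_mono[of j "max j (k + 1)"] by auto
  then have "B \<in> le k" using zero_if_all_ge zero_le by blast
  then show "X \<in> le k" using AB le_extension by blast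
qed

text \<open>Dually, vanishing of the cohomology below \<open>k\<close> pushes \<open>\<tau>\<^bsup><k\<^esup> X\<close> down into
  \<open>E\<^bsup>\<le>j\<^esup>\<close> for all \<open>j\<close>.\<close>

lemma ge_iff_cohomology:
  assumes X: "X \<in> Obj C"
  shows "X \<in> ge k \<longleftrightarrow> (\<forall>i < k. zero_object C (cohomology C E i X))"
proof (intro iffI allI impI)
  fix i assume "X \<in> ge k" "i < k"
  then have "X \<in> ge (i + 1)" using ge_mono[of "i + 1" k] by auto
  moreover obtain Z where "zero_object C Z" using zero_object_exists by blast
  ultimately show "zero_object C (cohomology C E i X)"
    using zero_cohomology_iff[OF tri_zero_left] zero_le X by blast
next
  assume zero: "\<forall>i < k. zero_object C (cohomology C E i X)"
  obtain A B where AB: "A \<in> le (k - 1)" "B \<in> ge (k - 1 + 1)" "tri A X B"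
    using truncation X by blast
  have "A \<in> le j" if "j \<le> k - 1" for j
    using that
  proof (induction j rule: int_le_induct)
    case (step j)
    have "B \<in> ge (j + 1)" using AB ge_mono[of "j + 1" k] step by auto
    moreover have "zero_object C (cohomology C E j X)" using zero step by auto
    ultimately show ?case using zero_cohomology_iff AB step by blast
  qed (use AB in blast)
  then have "A \<in> le j" for j using le_mono[of "min j (k - 1)" j] by auto
  then have "A \<in> ge k" using zero_if_all_le zero_ge by blast
  then show "X \<in> ge k" using AB ge_extension by auto
qed

text \<open>For \<open>X \<in> E\<^bsup>\<le>i\<^esup>\<close> the truncation \<open>\<tau>\<^bsup>\<le>i\<^esup> X\<close> is \<open>X\<close>, so \<open>H\<^sup>i(X)[-i]\<close> is a
  truncation of \<open>X\<close>; for \<open>X \<in> E\<^bsup>\<ge>i\<^esup>\<close> the truncation \<open>\<tau>\<^bsup>\<le>i\<^esup> X\<close> already lies in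
  \<open>E\<^bsup>\<ge>i\<^esup>\<close> and is therefore \<open>H\<^sup>i(X)[-i]\<close>.\<close>

lemma top_cohomology:
  assumes "X \<in> le i"
  obtains A where "A \<in> le (i - 1)" "tri A X (shift_obj C (- i) (cohomology C E i X))"
proof -
  let ?H = "shift_obj C (- i) (cohomology C E i X)"
  have X: "X \<in> Obj C" using assms le_Obj by blast
  obtain A B A' where h: "A \<in> le i" "B \<in> ge (i + 1)" "tri A X B"
    "A' \<in> le (i - 1)" "tri A' A ?H" "?H \<in> ge i"
    using cohomology_truncations[OF X] .
  obtain Z where Z: "zero_object C Z" using zero_object_exists by blast
  have "isomorphic C A X"
    using truncation_unique(1)[OF h(3) tri_zero_right[OF Z X]] h assms zero_ge[OF Z] by blast
  then have "tri A' X ?H" using tri_iso[OF h(5)] iso_refl h(5) tri_Obj by blast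
  then show ?thesis using that h by blast
qed

lemma bottom_cohomology:
  assumes "X \<in> ge i"
  obtains B where "B \<in> ge (i + 1)" "tri (shift_obj C (- i) (cohomology C E i X)) X B"
proof -
  let ?H = "shift_obj C (- i) (cohomology C E i X)"
  have X: "X \<in> Obj C" using assms le_Obj ge_Obj by blast
  obtain A B A' where h: "A \<in> le i" "B \<in> ge (i + 1)" "tri A X B"
    "A' \<in> le (i - 1)" "tri A' A ?H" "?H \<in> ge i"
    using cohomology_truncations[OF X] .
  obtain Z where Z: "zero_object C Z" using zero_object_exists by blast
  have "B \<in> ge (i - 1)" using h ge_mono[of "i - 1" "i + 1"] by auto
  then have "A \<in> ge (i - 1 + 1)" using ge_cocone[OF h(3) assms] by simp
  moreover have "?H \<in> ge (i - 1 + 1)" using h by simp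
  moreover have A: "A \<in> Obj C" using h le_Obj by blast
  ultimately have "isomorphic C ?H A"
    using truncation_unique(2)[OF h(5) tri_zero_left[OF Z A] h(4) zero_le[OF Z]] by blast
  then have "tri ?H X B" using tri_iso[OF h(3)] iso_refl iso_sym h(3) tri_Obj by blast
  then show ?thesis using that h by blast
qed

end

section \<open>Full subcategories and the heart\<close>

context triangulated_category
begin

lemma Hom_restrict:
  "Hom (restrict_category C S) A B = (if A \<in> S \<and> B \<in> S then Hom C A B else {})"
  by (auto simp: Hom_def restrict_category_def)

lemma restrict_simps:
  "Obj (restrict_category C S) = S" "Comp (restrict_category C S) = Comp C"
  "Ident (restrict_category C S) = Ident C" "Plus (restrict_category C S) = Plus C"
  "ZeroArr (restrict_category C S) = ZeroArr C"
  by (simp_all add: restrict_category_def)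

text \<open>Torsion classes have to be full subcategories of the heart; this reduces the question to the
  ambient category. The only delicate point is a zero object of the subcategory: its identity
  is zero, so it is a zero object everywhere.\<close>

lemma full_subcategory_restrict:
  assumes S: "full_subcategory C S" and U: "S \<subseteq> U" "U \<subseteq> Obj C"
  shows "full_subcategory (restrict_category C U) S"
  unfolding full_subcategory_def
proof (intro conjI ballI allI impI)
  show "S \<subseteq> Obj (restrict_category C U)" using U by (simp add: restrict_simps)
next
  fix A B assume A: "A \<in> S" and iso: "isomorphic (restrict_category C U) A B"
  then have "isomorphic C A B"
    unfolding isomorphic_def is_iso_def Hom_restrict restrict_simps by (auto split: if_splits)
  then show "B \<in> S" using full_subcategory_closure(2)[OF S A] by blast
next
  fix Z assume Z: "zero_object (restrict_category C U) Z"
  then have ZU: "Z \<in> U" and "\<forall>A \<in> U. \<exists>!f. f \<in> (if A \<in> U \<and> Z \<in> U then Hom C A Z else {})"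
    unfolding zero_object_def Hom_restrict restrict_simps by blast+
  then have e: "\<exists>!f. f \<in> Hom C Z Z" by simp
  have "Z \<in> Obj C" using ZU U by blast
  then have "orth Z Z" using e Zero_closed[of Z Z] by (intro orthI) auto
  then show "Z \<in> S" using full_subcategory_closure(3)[OF S] zero_object_iff_orth by blast
next
  fix A B P assume A: "A \<in> S" "B \<in> S" and P: "biproduct (restrict_category C U) A B P"
  have "P \<in> U" using P unfolding biproduct_def restrict_simps by blast
  then have "biproduct C A B P"
    using P A U unfolding biproduct_def Hom_restrict restrict_simps by (auto split: if_splits)
  then show "P \<in> S" using S A unfolding full_subcategory_def by blast
qed

lemma full_subcategory_Int:
  assumes "full_subcategory C S" "full_subcategory C U"
  shows "full_subcategory C (S \<inter> U)"
  unfolding full_subcategory_def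
proof (intro conjI ballI allI impI)
  fix A B P assume "A \<in> S \<inter> U" "B \<in> S \<inter> U" "biproduct C A B P"
  then show "P \<in> S \<inter> U" using assms unfolding full_subcategory_def by blast
qed (use full_subcategory_closure[OF assms(1)] full_subcategory_closure[OF assms(2)] in auto)

lemma orth_biproduct:
  assumes P: "biproduct C A B P" and o: "orth W A" "orth W B"
  shows "orth W P"
proof -
  obtain i j p q where h: "i \<in> Hom C A P" "j \<in> Hom C B P" "p \<in> Hom C P A" "q \<in> Hom C P B"
    and id: "Plus C (i \<cdot> p) (j \<cdot> q) = Ident C P"
    using P unfolding biproduct_def by blast
  have obj: "W \<in> Obj C" "P \<in> Obj C" using o orth_Obj h Hom_Obj by blast+
  show ?thesis
  proof (rule orthI[OF obj])
    fix f assume f: "f \<in> Hom C W P"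
    have z: "p \<cdot> f = ZeroArr C W A" "q \<cdot> f = ZeroArr C W B"
      using o orthD Comp_closed[OF f] h by blast+
    have "f = Plus C (i \<cdot> p) (j \<cdot> q) \<cdot> f" using id Comp_Ident_left[OF f] by simp
    also have "\<dots> = Plus C ((i \<cdot> p) \<cdot> f) ((j \<cdot> q) \<cdot> f)"
      by (rule Comp_Plus_left[OF f Comp_closed[OF h(3,1)] Comp_closed[OF h(4,2)]])
    also have "\<dots> = Plus C (ZeroArr C W P) (ZeroArr C W P)"
      using Comp_assoc[OF f h(3,1)] Comp_assoc[OF f h(4,2)] z
        Comp_Zero_right[OF h(1) obj(1)] Comp_Zero_right[OF h(2) obj(1)] by simp
    finally show "f = ZeroArr C W P" using Plus_Zero[OF obj Zero_closed[OF obj]] by simp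
  qed
qed

end

context category_with_t_structure
begin

lemma ge_full: "full_subcategory C (ge i)"
  unfolding full_subcategory_def
proof (intro conjI ballI allI impI)
  fix A B P assume A: "A \<in> ge i" "B \<in> ge i" and P: "biproduct C A B P"
  have "P \<in> Obj C" using P unfolding biproduct_def by blast
  moreover have "orth W P" if "W \<in> le (i - 1)" for W
    using orth_biproduct[OF P orth_le_ge[OF that A(1)] orth_le_ge[OF that A(2)]] by simp
  ultimately show "P \<in> ge i" using ge_iff_orth[of P "i - 1"] by simp
qed (auto intro: zero_ge ge_iso ge_Obj)

lemma heart_full: "full_subcategory C (heart_objects E)"
  unfolding heart_objects_def by (rule full_subcategory_Int[OF aisle_full coaisle_full])

lemma mem_heart: "X \<in> heart_objects E \<longleftrightarrow> X \<in> le 0 \<and> X \<in> ge 0"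
  by (simp add: heart_objects_def le_0 ge_0)

text \<open>For objects \<open>X\<close>, \<open>Y\<close> of the heart \<open>Hom(X[1], Y) = 0\<close>. This is the uniqueness of the
  factorisations that exactness of \<open>Hom\<close> yields.\<close>

lemma dist_triangle_short_exact:
  assumes D: "dist_triangle C K L M u v w"
    and h: "K \<in> heart_objects E" "L \<in> heart_objects E" "M \<in> heart_objects E"
  shows "short_exact (heart C E) K L M u v"
  unfolding short_exact_def is_kernel_def is_cokernel_def heart_def Hom_restrict restrict_simps
proof (intro conjI ballI impI)
  note d = dist_triangleD[OF D]
  have shift: "Shift C X \<in> le (- 1)" if "X \<in> heart_objects E" for X
    using that Shift_le[of X "- 1"] le_Obj[of X] by (auto simp: mem_heart)
  have o: "orth (Shift C X) Y" if "X \<in> heart_objects E" "Y \<in> heart_objects E" for X Y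
    using orth_le_ge[OF shift] that by (auto simp: mem_heart)
  {
    fix W f assume W: "W \<in> heart_objects E"
      and f: "f \<in> (if W \<in> heart_objects E \<and> L \<in> heart_objects E then Hom C W L else {})"
      and z: "v \<cdot> f = ZeroArr C W M"
    from f W h have f: "f \<in> Hom C W L" by simp
    obtain g where g: "g \<in> Hom C W K" "u \<cdot> g = f" using dist_lift[OF D f z] .
    show "\<exists>!g. g \<in> (if W \<in> heart_objects E \<and> K \<in> heart_objects E then Hom C W K else {}) \<and>
        u \<cdot> g = f"
    proof (rule ex1I[of _ g])
      fix g' assume "g' \<in> (if W \<in> heart_objects E \<and> K \<in> heart_objects E then Hom C W K else {}) \<and>
        u \<cdot> g' = f"
      then show "g' = g" using W h g dist_mono[OF D o[OF W h(3)], of g' g] by simp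
    qed (use W h g in simp)
  next
    fix W f assume W: "W \<in> heart_objects E"
      and f: "f \<in> (if L \<in> heart_objects E \<and> W \<in> heart_objects E then Hom C L W else {})"
      and z: "f \<cdot> u = ZeroArr C K W"
    from f W h have f: "f \<in> Hom C L W" by simp
    obtain g where g: "g \<in> Hom C M W" "g \<cdot> v = f" using dist_colift[OF D f z] .
    show "\<exists>!g. g \<in> (if M \<in> heart_objects E \<and> W \<in> heart_objects E then Hom C M W else {}) \<and>
        g \<cdot> v = f"
    proof (rule ex1I[of _ g])
      fix g' assume "g' \<in> (if M \<in> heart_objects E \<and> W \<in> heart_objects E then Hom C M W else {}) \<and>
        g' \<cdot> v = f"
      then show "g' = g" using W h g dist_epi[OF D o[OF h(1) W], of g' g] by simp
    qed (use W h g in simp)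
  }
qed (use dist_triangleD[OF D] dist_comp_zero[OF D] h in auto)

end

section \<open>Comparing two t-structures\<close>

locale t_structure_pair = category_with_t_structure C E + F: category_with_t_structure C F
  for C :: "('o, 'm, 'z) triangulated_category_scheme" (structure) and E F :: "'o tstr"
begin

lemma ge_subset_shift:
  assumes "ge i \<subseteq> F.ge j"
  shows "ge (i + k) \<subseteq> F.ge (j + k)"
proof
  fix X assume X: "X \<in> ge (i + k)"
  then have "shift_obj C k X \<in> ge i" using shift_ge ge_Obj by blast
  then show "X \<in> F.ge (j + k)" using assms F.shift_ge ge_Obj[OF X] by blast
qed

lemma ge_subset_if_le_subset:
  assumes "F.le j \<subseteq> le i"
  shows "ge (i + 1) \<subseteq> F.ge (j + 1)"
proof
  fix X assume "X \<in> ge (i + 1)"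
  then show "X \<in> F.ge (j + 1)" using assms unfolding F.ge_iff_orth ge_iff_orth by blast
qed

lemma le_subset_if_ge_subset:
  assumes "ge (i + 1) \<subseteq> F.ge (j + 1)"
  shows "F.le j \<subseteq> le i"
proof
  fix X assume "X \<in> F.le j"
  then show "X \<in> le i" using assms unfolding F.le_iff_orth le_iff_orth by blast
qed

lemma eq_if_coaisle_eq:
  assumes "coaisle E = coaisle F"
  shows "E = F"
proof (rule prod_eqI)
  have ge: "ge 1 = F.ge 1" unfolding ge_part_def assms ..
  show "aisle E = aisle F"
    unfolding le_0[symmetric] F.le_0[symmetric]
    using ge by (auto simp: le_iff_orth F.le_iff_orth)
qed (rule assms)

end

text \<open>The hypotheses say \<open>F\<^bsup>\<ge>1\<^esup> \<subseteq> E\<^bsup>\<ge>0\<^esup> \<subseteq> F\<^bsup>\<ge>0\<^esup>\<close>; equivalently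
  \<open>E\<^bsup>\<le>-1\<^esup> \<subseteq> F\<^bsup>\<le>0\<^esup> \<subseteq> E\<^bsup>\<le>0\<^esup>\<close>.\<close>

locale tilted_pair = t_structure_pair +
  assumes coaisle_subset: "coaisle E \<subseteq> coaisle F"
    and ge_1_subset: "F.ge 1 \<subseteq> coaisle E"
begin

lemma ge_subset: "ge i \<subseteq> F.ge i"
  using ge_subset_shift[of 0 0 i] coaisle_subset by (simp add: ge_0 F.ge_0)

lemma F_ge_subset: "F.ge (i + 1) \<subseteq> ge i"
proof -
  interpret swap: t_structure_pair C F E ..
  show ?thesis
    using swap.ge_subset_shift[of 1 0 i] ge_1_subset by (simp add: ge_0 add.commute)
qed

lemma F_le_subset: "F.le i \<subseteq> le i"
  by (rule le_subset_if_ge_subset[OF ge_subset])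

lemma le_subset: "le i \<subseteq> F.le (i + 1)"
proof -
  interpret swap: t_structure_pair C F E ..
  show ?thesis by (rule swap.le_subset_if_ge_subset[OF F_ge_subset])
qed

text \<open>Let \<open>K \<rightarrow> L \<rightarrow> M\<close> be the \<open>F\<close>-truncation triangle of \<open>L\<close> in the heart of \<open>E\<close>. The inclusions
  give \<open>K \<in> E\<^bsup>\<le>0\<^esup>\<close> and \<open>M \<in> E\<^bsup>\<ge>0\<^esup>\<close>. The other two memberships follow from the
  triangle, as \<open>M\<close> is an extension of \<open>K[1]\<close> by \<open>L\<close> and \<open>K\<close> is an extension of \<open>L\<close> by
  \<open>M[-1]\<close>.\<close>

lemma torsion_pair:
  "torsion_pair (heart C E) (aisle F \<inter> heart_objects E) (F.ge 1 \<inter> heart_objects E)"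
  unfolding torsion_pair_def
proof (intro conjI ballI)
  have H: "heart_objects E \<subseteq> Obj C" using mem_heart le_Obj by blast
  show "full_subcategory (heart C E) (aisle F \<inter> heart_objects E)"
    unfolding heart_def
    by (rule full_subcategory_restrict[OF full_subcategory_Int[OF F.aisle_full heart_full] _ H]) auto
  show "full_subcategory (heart C E) (F.ge 1 \<inter> heart_objects E)"
    unfolding heart_def
    by (rule full_subcategory_restrict[OF full_subcategory_Int[OF F.ge_full heart_full] _ H]) auto
next
  fix K M assume K: "K \<in> aisle F \<inter> heart_objects E" and M: "M \<in> F.ge 1 \<inter> heart_objects E"
  have "orth K M" using F.orth_le_ge[of K 0 M 1] K M by (simp add: F.le_0)
  then show "Hom (heart C E) K M = {ZeroArr (heart C E) K M}"
    using K M unfolding orth_def heart_def Hom_restrict restrict_simps by simp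
next
  fix L assume "L \<in> Obj (heart C E)"
  then have L: "L \<in> heart_objects E" by (simp add: heart_def restrict_simps)
  then have L': "L \<in> le 0" "L \<in> ge 0" by (simp_all add: mem_heart)
  obtain K M where KM: "K \<in> F.le 0" "M \<in> F.ge (0 + 1)" "tri K L M"
    using F.truncation[OF le_Obj[OF L'(1)]] .
  have K0: "K \<in> le 0" using KM F_le_subset by blast
  have M0: "M \<in> ge 0" using KM F_ge_subset by blast
  have "K \<in> le (0 + 1)" using K0 le_mono[of 0 "0 + 1"] by auto
  then have "M \<in> le 0" using le_cone[OF KM(3)] L' by blast
  moreover have "M \<in> ge (0 - 1)" using M0 ge_mono[of "0 - 1" 0] by auto
  then have "K \<in> ge 0" using ge_cocone[OF KM(3)] L' by blast
  ultimately have h: "K \<in> heart_objects E" "M \<in> heart_objects E"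
    using K0 M0 by (simp_all add: mem_heart)
  obtain u v w where "dist_triangle C K L M u v w" using KM unfolding tri_def by blast
  then have "short_exact (heart C E) K L M u v" using dist_triangle_short_exact h L by blast
  then show "\<exists>K \<in> aisle F \<inter> heart_objects E. \<exists>M \<in> F.ge 1 \<inter> heart_objects E. \<exists>f g.
      short_exact (heart C E) K L M f g"
    using KM h by (auto simp: F.le_0)
qed

text \<open>The difference between \<open>X\<close> and its top cohomology lies in \<open>E\<^bsup>\<le>-1\<^esup> \<subseteq> F\<^bsup>\<le>0\<^esup>\<close>.
  The class \<open>F\<^bsup>\<le>0\<^esup>\<close> is closed under extensions and under cones of arrows out of objects of
  \<open>F\<^bsup>\<le>1\<^esup>\<close>, so \<open>X\<close> and the cohomology belong to \<open>F\<^bsup>\<le>0\<^esup>\<close> simultaneously.\<close>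

lemma mem_F_le_iff:
  assumes X: "X \<in> le 0"
  shows "X \<in> F.le 0 \<longleftrightarrow> cohomology C E 0 X \<in> F.le 0"
proof -
  let ?H = "cohomology C E 0 X"
  obtain A where A: "A \<in> le (0 - 1)" and t: "tri A X ?H"
    using top_cohomology[OF X] by (auto simp: shift_obj_0)
  have A0: "A \<in> F.le 0" using A le_subset[of "- 1"] by auto
  then have "A \<in> F.le (0 + 1)" using F.le_mono[of 0 "0 + 1"] by auto
  then show ?thesis using A0 t F.le_cone[OF t] F.le_extension[OF t] by blast
qed

text \<open>The difference between \<open>X\<close> and \<open>H\<^bsup>-1\<^esup>(X)[1]\<close> lies in \<open>E\<^bsup>\<ge>0\<^esup> \<subseteq> F\<^bsup>\<ge>0\<^esup>\<close>. The
  shift by one explains why the torsion-free class is cut out by \<open>F\<^bsup>\<ge>1\<^esup>\<close>.\<close>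

lemma mem_F_ge_iff:
  assumes X: "X \<in> ge (- 1)"
  shows "X \<in> F.ge 0 \<longleftrightarrow> cohomology C E (- 1) X \<in> F.ge 1"
proof -
  let ?H = "cohomology C E (- 1) X"
  obtain B where B: "B \<in> ge 0" and t: "tri (shift_obj C 1 ?H) X B"
    using bottom_cohomology[OF X] by auto
  have B0: "B \<in> F.ge 0" using B ge_subset by blast
  then have "B \<in> F.ge (0 - 1)" using F.ge_mono[of "0 - 1" 0] by auto
  then have "X \<in> F.ge 0 \<longleftrightarrow> shift_obj C 1 ?H \<in> F.ge 0"
    using B0 t F.ge_cocone[OF t] F.ge_extension[OF t] by blast
  then show ?thesis using F.shift_ge[OF cohomology_Obj[OF ge_Obj[OF X], of "- 1"], of 1 0] by simp
qed

lemma tilt_eq: "tilt C E (aisle F \<inter> heart_objects E) (F.ge 1 \<inter> heart_objects E) = F"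
proof (rule prod_eqI)
  have "X \<in> aisle F \<longleftrightarrow> X \<in> Obj C \<and> cohomology C E 0 X \<in> aisle F \<inter> heart_objects E \<and>
      (\<forall>i > 0. zero_object C (cohomology C E i X))" for X
  proof -
    have "X \<in> F.le 0 \<longleftrightarrow> X \<in> Obj C \<and> X \<in> le 0 \<and> X \<in> F.le 0"
      using F_le_subset le_Obj by blast
    also have "\<dots> \<longleftrightarrow> X \<in> Obj C \<and> X \<in> le 0 \<and> cohomology C E 0 X \<in> F.le 0"
      using mem_F_le_iff by blast
    finally show ?thesis
      using cohomology_heart[of X 0] le_iff_cohomology[of X 0] by (auto simp: F.le_0)
  qed
  then show "aisle (tilt C E (aisle F \<inter> heart_objects E) (F.ge 1 \<inter> heart_objects E)) = aisle F"
    by (simp only: tilt_def fst_conv set_eq_iff mem_Collect_eq simp_thms)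
  have "X \<in> coaisle F \<longleftrightarrow> X \<in> Obj C \<and> cohomology C E (- 1) X \<in> F.ge 1 \<inter> heart_objects E \<and>
      (\<forall>i < - 1. zero_object C (cohomology C E i X))" for X
  proof -
    have "X \<in> F.ge 0 \<longleftrightarrow> X \<in> Obj C \<and> X \<in> ge (- 1) \<and> X \<in> F.ge 0"
      using F_ge_subset[of "- 1"] ge_Obj by auto
    also have "\<dots> \<longleftrightarrow> X \<in> Obj C \<and> X \<in> ge (- 1) \<and> cohomology C E (- 1) X \<in> F.ge 1"
      using mem_F_ge_iff by blast
    finally show ?thesis
      using cohomology_heart[of X "- 1"] ge_iff_cohomology[of X "- 1"] by (auto simp: F.ge_0)
  qed
  then show "coaisle (tilt C E (aisle F \<inter> heart_objects E) (F.ge 1 \<inter> heart_objects E)) = coaisle F"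
    by (simp only: tilt_def snd_conv set_eq_iff mem_Collect_eq simp_thms)
qed

end

section \<open>The iterated tilting sequence\<close>

theorem theorem2p13:
  fixes C :: "('o, 'm) triangulated_category" and D T :: "'o tstr" and n :: nat
  assumes "triangulated_category C"
    and "t_structure C D" and "t_structure C T"
    and "right_filterable C D T"
    and "has_type C D T n 0"
  shows "iterated_HRS C D T n"
proof -
  interpret triangulated_category C by fact
  interpret D: category_with_t_structure C D by unfold_locales fact
  interpret T: category_with_t_structure C T by unfold_locales fact
  interpret DT: t_structure_pair C D T ..
  interpret TD: t_structure_pair C T D ..
  have "T.le 0 \<subseteq> D.le 0" and "D.le (- int n) \<subseteq> T.le 0"
    using assms(5) unfolding has_type_def by (auto simp: D.le_0)
  then have "D.ge 1 \<subseteq> T.ge 1" and "T.ge 1 \<subseteq> D.ge (1 - int n)"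
    using DT.ge_subset_if_le_subset[of 0 0] TD.ge_subset_if_le_subset[of "- int n" 0] by auto
  then have DT: "coaisle D \<subseteq> coaisle T" and TD: "coaisle T \<subseteq> D.ge (- int n)"
    using DT.ge_subset_shift[of 1 1 "- 1"] TD.ge_subset_shift[of 1 "1 - int n" "- 1"]
    by (auto simp: D.ge_0 T.ge_0)
  \<comment> \<open>Also for \<open>i > n\<close> this is a t-structure, so the comparison of neighbours below needs no bound
    on \<open>i\<close>.\<close>
  define E where
    "E i = (SOME E. t_structure C E \<and> coaisle E = D.ge (- int i) \<inter> coaisle T)" for i :: nat
  have E: "t_structure C (E i)" "coaisle (E i) = D.ge (- int i) \<inter> coaisle T" for i
    using someI_ex[OF assms(4)[unfolded right_filterable_def, rule_format, of "- int i"]]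
    unfolding E_def by auto
  have E_eq: "E i = F" if "t_structure C F" "coaisle (E i) = coaisle F" for i F
  proof -
    interpret t_structure_pair C "E i" F by unfold_locales (fact E that)+
    show ?thesis using eq_if_coaisle_eq that by blast
  qed
  have "E 0 = D" using E_eq[OF assms(2), of 0] E(2)[of 0] DT by (auto simp: D.ge_0)
  moreover have "E n = T" using E_eq[OF assms(3), of n] E(2)[of n] TD by auto
  moreover have "\<exists>X Y. torsion_pair (heart C (E i)) X Y \<and> E (Suc i) = tilt C (E i) X Y" for i
  proof -
    interpret Ei: category_with_t_structure C "E i" by unfold_locales (rule E)
    interpret F: category_with_t_structure C "E (Suc i)" by unfold_locales (rule E)
    interpret tilted_pair C "E i" "E (Suc i)"
    proof unfold_locales
      show "coaisle (E i) \<subseteq> coaisle (E (Suc i))"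
        using E(2) D.ge_mono[of "- int (Suc i)" "- int i"] by auto
      show "F.ge 1 \<subseteq> coaisle (E i)"
      proof
        fix X assume X: "X \<in> F.ge 1"
        then have XO: "X \<in> Obj C" and "shift_obj C 1 X \<in> coaisle (E (Suc i))"
          by (simp_all add: F.mem_ge)
        then have "shift_obj C 1 X \<in> D.ge (- int (Suc i))" "shift_obj C 1 X \<in> T.ge 0"
          using E(2) by (auto simp: T.ge_0)
        then have "X \<in> D.ge (- int i)" "X \<in> T.ge 1"
          using D.shift_ge[OF XO] T.shift_ge[OF XO] by auto
        then show "X \<in> coaisle (E i)"
          using E(2)[of i] T.ge_mono[of 0 1] by (auto simp: T.ge_0)
      qed
    qed
    show ?thesis using torsion_pair tilt_eq by metis
  qed
  ultimately show ?thesis using E(1) unfolding iterated_HRS_def by blast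
qed

end
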